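(* Let $N\ge2$, $T>0$, $\nu>0$. Let $v\in L^\infty(0,T;L^2_\sigma(\mathbb{R}^N))\cap L^2(0,T;H^1_\sigma(\mathbb{R}^N))$ be Leray's weak solution to $(NS)_\nu$ on $\mathbb{R}^N\times(0,T)$, with associated pressure $p$ and with $f\in L^2(0,T;L^2_\sigma(\mathbb{R}^N))$. Suppose that $p(x,t)\to0$ as $|x|\to\infty$ for almost every $t\in(0,T)$, and that there exists $w\in L^1(0,\infty)$ such that, for some constant $C>0$, $0<w(r)\le\frac{C}{1+r}$ for almost every $r\in[0,\infty)$, and $$\int_{\mathbb{R}^N}p(x,t)\left[w(|x|)+\frac{N-1}{|x|}\int_0^{|x|}w(s)\,ds\right]dx\ge0\quad\text{for almost every } t\in(0,T).$$ Then $v(x,t)=0$ almost everywhere on $\mathbb{R}^N\times(0,T)$.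
   Context: For $N\ge 2$ and $\nu>0$, $(NS)_\nu$ denotes the Navier-Stokes equations on $\mathbb{R}^N$: $\partial_t v+(v\cdot\nabla)v=-\nabla p+\nu\Delta v+f$, $\operatorname{div} v=0$, $v(x,0)=v_0(x)$, with velocity $v=(v^1,\dots,v^N)(x,t)$, pressure $p(x,t)$, external force $f=(f^1,\dots,f^N)(x,t)$ and viscosity $\nu$. For $q\in[1,\infty]$, $L^q_\sigma(\mathbb{R}^N)$ (resp. $L^q_{loc,\sigma}(\mathbb{R}^N)$) is the class of vector fields in $[L^q(\mathbb{R}^N)]^N$ (resp. $[L^q_{loc}(\mathbb{R}^N)]^N$) that are divergence free in the sense of distributions, and $H^1_\sigma(\mathbb{R}^N)$ is the class of divergence-free vector fields in $[W^{1,2}(\mathbb{R}^N)]^N$. For $a,b\in\mathbb{R}^N$, $(a\otimes b)_{ij}=a_ib_j$; for $N\times N$ matrices, $A:B=\sum_{i,j=1}^N A_{ij}B_{ij}$. Weak solution: a pair $(v,p)\in L^2(0,T;L^2_{loc,\sigma}(\mathbb{R}^N))\times L^1(0,T;L^1_{loc}(\mathbb{R}^N))$ is a weak solution of $(NS)_\nu$ on $\mathbb{R}^N\times(0,T)$ with $f\in L^1(0,T;L^1_{loc,\sigma}(\mathbb{R}^N))$ if $$-\int_0^T\!\int_{\mathbb{R}^N} v\cdot\phi(x)\,\xi'(t)\,dx\,dt-\int_0^T\!\int_{\mathbb{R}^N} v\otimes v:\nabla\phi(x)\,\xi(t)\,dx\,dt=\int_0^T\!\int_{\mathbb{R}^N}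 p\,\operatorname{div}\phi(x)\,\xi(t)\,dx\,dt+\nu\int_0^T\!\int_{\mathbb{R}^N} v\cdot\Delta\phi(x)\,\xi(t)\,dx\,dt+\int_0^T\!\int_{\mathbb{R}^N} f\cdot\phi(x)\,\xi(t)\,dx\,dt$$ for all $\xi\in C^1_0(0,T)$ and $\phi\in[C_0^\infty(\mathbb{R}^N)]^N$ (subscript $0$ denotes compact support). Leray's weak solution is meant in the standard sense: a weak solution $(v,p)$ of $(NS)_\nu$ on $\mathbb{R}^N\times(0,T)$ with external force $f$, that is, a pair $(v,p)\in L^2(0,T;L^2_{loc,\sigma}(\mathbb{R}^N))\times L^1(0,T;L^1_{loc}(\mathbb{R}^N))$ satisfying $$-\int_0^T\!\int_{\mathbb{R}^N} v\cdot\phi(x)\,\xi'(t)\,dx\,dt-\int_0^T\!\int_{\mathbb{R}^N} v\otimes v:\nabla\phi(x)\,\xi(t)\,dx\,dt=\int_0^T\!\int_{\mathbb{R}^N} p\,\operatorname{div}\phi(x)\,\xi(t)\,dx\,dt+\nu\int_0^T\!\int_{\mathbb{R}^N} v\cdot\Delta\phi(x)\,\xi(t)\,dx\,dt+\int_0^T\!\int_{\mathbb{R}^N} f\cdot\phi(x)\,\xi(t)\,dx\,dt$$ for all $\xi\in C^1_0(0,T)$ and $\phi\in[C_0^\infty(\mathbb{R}^N)]^N$, with $v\in L^\infty(0,T;L^2_\sigma(\mathbb{R}^N))\cap L^2(0,T;H^1_\sigma(\mathbb{R}^N))$, initial datum $v_0\in L^2_\sigma(\mathbb{R}^N)$, and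 satisfying the energy inequality $\frac12\|v(t)\|_{L^2}^2+\nu\int_0^t\|\nabla v\|_{L^2}^2\,ds\le\frac12\|v_0\|_{L^2}^2+\int_0^t\int_{\mathbb{R}^N}f\cdot v\,dx\,ds$ for almost every $t\in(0,T)$. *)

theory Defs
  imports "HOL-Analysis.Analysis"
begin

section \<open>Differential operators and test functions\<close>

definition pderiv_at :: "'n::finite \<Rightarrow> (real^'n \<Rightarrow> real) \<Rightarrow> real^'n \<Rightarrow> real" where
  "pderiv_at i g x = frechet_derivative g (at x) (axis i 1)"

primrec Ck :: "nat \<Rightarrow> (real^'n::finite \<Rightarrow> real) \<Rightarrow> bool" where
  "Ck 0 g \<longleftrightarrow> continuous_on UNIV g"
| "Ck (Suc k) g \<longleftrightarrow> (\<forall>x. g differentiable (at x)) \<and> (\<forall>i. Ck k (pderiv_at i g))"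

definition test_functions :: "(real^'n::finite \<Rightarrow> real) set" where
  "test_functions = {\<psi>. (\<forall>k. Ck k \<psi>) \<and> compact (closure {x. \<psi> x \<noteq> 0})}"

definition test_fields :: "(real^'n::finite \<Rightarrow> real^'n) set" where
  "test_fields = {\<phi>. \<forall>i. (\<lambda>x. \<phi> x $ i) \<in> test_functions}"

text \<open>Elements of $C^1_0(0,T)$, extended by zero to the real line.\<close>

definition time_tests :: "real \<Rightarrow> (real \<Rightarrow> real) set" where
  "time_tests T = {\<xi>. \<xi> C1_differentiable_on UNIV \<and>
     compact (closure {t. \<xi> t \<noteq> 0}) \<and> closure {t. \<xi> t \<noteq> 0} \<subseteq> {0<..<T}}"

definition grad :: "(real^'n::finite \<Rightarrow> real) \<Rightarrow> real^'n \<Rightarrow> real^'n" where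
  "grad \<psi> x = (\<chi> i. pderiv_at i \<psi> x)"

definition grad_field :: "(real^'n::finite \<Rightarrow> real^'n) \<Rightarrow> real^'n \<Rightarrow> real^'n^'n" where
  "grad_field \<phi> x = (\<chi> i j. pderiv_at i (\<lambda>y. \<phi> y $ j) x)"

definition divergence :: "(real^'n::finite \<Rightarrow> real^'n) \<Rightarrow> real^'n \<Rightarrow> real" where
  "divergence \<phi> x = (\<Sum>i\<in>UNIV. pderiv_at i (\<lambda>y. \<phi> y $ i) x)"

definition laplacian_field :: "(real^'n::finite \<Rightarrow> real^'n) \<Rightarrow> real^'n \<Rightarrow> real^'n" where
  "laplacian_field \<phi> x = (\<chi> j. \<Sum>i\<in>UNIV. pderiv_at i (pderiv_at i (\<lambda>y. \<phi> y $ j)) x)"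

definition tensor :: "real^'n::finite \<Rightarrow> real^'n \<Rightarrow> real^'n^'n" where
  "tensor a b = (\<chi> i j. a $ i * b $ j)"

definition ddot :: "real^'n::finite^'n \<Rightarrow> real^'n^'n \<Rightarrow> real" where
  "ddot A B = (\<Sum>i\<in>UNIV. \<Sum>j\<in>UNIV. A $ i $ j * B $ i $ j)"


section \<open>Lebesgue and Sobolev spaces\<close>

text \<open>Functions rather than equivalence classes; all notions below are invariant under
  modification on null sets. Exponents range over $[1,\infty]$.\<close>

definition Lq :: "ennreal \<Rightarrow> 'a measure \<Rightarrow> ('a \<Rightarrow> 'b::euclidean_space) set" where
  "Lq q M = {u \<in> borel_measurable M.
     if q = \<infinity> then \<exists>B. AE x in M. norm (u x) \<le> B
     else integrable M (\<lambda>x. norm (u x) powr enn2real q)}"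

definition Lq_norm :: "ennreal \<Rightarrow> 'a measure \<Rightarrow> ('a \<Rightarrow> 'b::euclidean_space) \<Rightarrow> real" where
  "Lq_norm q M u =
     (if q = \<infinity> then Inf {B. 0 \<le> B \<and> (AE x in M. norm (u x) \<le> B)}
      else (LINT x|M. norm (u x) powr enn2real q) powr (1 / enn2real q))"

definition Lq_loc :: "ennreal \<Rightarrow> (real^'n::finite \<Rightarrow> 'b::euclidean_space) set" where
  "Lq_loc q = {u. \<forall>K. compact K \<longrightarrow> u \<in> Lq q (lebesgue_on K)}"

definition div_free :: "(real^'n::finite \<Rightarrow> real^'n) \<Rightarrow> bool" where
  "div_free u \<longleftrightarrow> (\<forall>\<psi>\<in>test_functions. (LINT x|lebesgue. u x \<bullet> grad \<psi> x) = 0)"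

definition Lq_sigma :: "ennreal \<Rightarrow> (real^'n::finite \<Rightarrow> real^'n) set" where
  "Lq_sigma q = {u \<in> Lq q lebesgue. div_free u}"

definition Lq_loc_sigma :: "ennreal \<Rightarrow> (real^'n::finite \<Rightarrow> real^'n) set" where
  "Lq_loc_sigma q = {u \<in> Lq_loc q. div_free u}"

definition is_weak_grad :: "(real^'n::finite \<Rightarrow> real^'n) \<Rightarrow> (real^'n \<Rightarrow> real^'n^'n) \<Rightarrow> bool" where
  "is_weak_grad u G \<longleftrightarrow> u \<in> Lq_loc 1 \<and> G \<in> Lq_loc 1 \<and>
     (\<forall>\<psi>\<in>test_functions. \<forall>i j.
        (LINT x|lebesgue. u x $ j * pderiv_at i \<psi> x) = - (LINT x|lebesgue. G x $ i $ j * \<psi> x))"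

text \<open>The weak gradient is determined only up to null sets, so any choice gives the same norms.\<close>

definition weak_grad :: "(real^'n::finite \<Rightarrow> real^'n) \<Rightarrow> real^'n \<Rightarrow> real^'n^'n" where
  "weak_grad u = (SOME G. is_weak_grad u G)"

definition H1_sigma :: "(real^'n::finite \<Rightarrow> real^'n) set" where
  "H1_sigma = {u \<in> Lq 2 lebesgue. (\<exists>G \<in> Lq 2 lebesgue. is_weak_grad u G) \<and> div_free u}"

definition H1_norm :: "(real^'n::finite \<Rightarrow> real^'n) \<Rightarrow> real" where
  "H1_norm u = sqrt ((Lq_norm 2 lebesgue u)\<^sup>2 + (Lq_norm 2 lebesgue (weak_grad u))\<^sup>2)"


section \<open>Functions of time with values in a function space\<close>

text \<open>\<^term>\<open>time_Lq q T S X\<close> is $L^q(0,T;X)$ for a space \<^term>\<open>X\<close> topologised by the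
  (semi)norms in \<^term>\<open>S\<close>: one norm for a Banach space, the local norms over all compact sets for
  $L^r_{loc}$. The spaces used are separable, so joint measurability stands in for Bochner
  measurability.\<close>

definition time_Lq :: "ennreal \<Rightarrow> real \<Rightarrow> ((real^'n::finite \<Rightarrow> 'b::euclidean_space) \<Rightarrow> real) set \<Rightarrow>
    (real^'n \<Rightarrow> 'b) set \<Rightarrow> (real^'n \<Rightarrow> real \<Rightarrow> 'b) set" where
  "time_Lq q T S X = {u.
     (\<lambda>z. u (fst z) (snd z)) \<in> borel_measurable (lebesgue_on (UNIV \<times> {0<..<T})) \<and>
     (AE t in lebesgue_on {0<..<T}. (\<lambda>x. u x t) \<in> X) \<and>
     (\<forall>s\<in>S. (\<lambda>t. s (\<lambda>x. u x t)) \<in> Lq q (lebesgue_on {0<..<T}))}"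

definition local_norms :: "ennreal \<Rightarrow> ((real^'n::finite \<Rightarrow> 'b::euclidean_space) \<Rightarrow> real) set" where
  "local_norms r = {Lq_norm r (lebesgue_on K) |K. compact K}"


section \<open>Weak solutions of the Navier--Stokes equations\<close>

text \<open>Velocity, pressure and force take the space variable first, then time.\<close>

definition NS_weak_solution :: "real \<Rightarrow> real \<Rightarrow> (real^'n::finite \<Rightarrow> real \<Rightarrow> real^'n) \<Rightarrow>
    (real^'n \<Rightarrow> real \<Rightarrow> real^'n) \<Rightarrow> (real^'n \<Rightarrow> real \<Rightarrow> real) \<Rightarrow> bool" where
  "NS_weak_solution \<nu> T f v p \<longleftrightarrow>
     v \<in> time_Lq 2 T (local_norms 2) (Lq_loc_sigma 2) \<and>
     p \<in> time_Lq 1 T (local_norms 1) (Lq_loc 1) \<and>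
     f \<in> time_Lq 1 T (local_norms 1) (Lq_loc_sigma 1) \<and>
     (\<forall>\<xi>\<in>time_tests T. \<forall>\<phi>\<in>test_fields.
        - (LINT t:{0<..<T}|lebesgue. LINT x|lebesgue. (v x t \<bullet> \<phi> x) * deriv \<xi> t)
        - (LINT t:{0<..<T}|lebesgue. LINT x|lebesgue.
             ddot (tensor (v x t) (v x t)) (grad_field \<phi> x) * \<xi> t)
        = (LINT t:{0<..<T}|lebesgue. LINT x|lebesgue. p x t * divergence \<phi> x * \<xi> t)
        + \<nu> * (LINT t:{0<..<T}|lebesgue. LINT x|lebesgue. (v x t \<bullet> laplacian_field \<phi> x) * \<xi> t)
        + (LINT t:{0<..<T}|lebesgue. LINT x|lebesgue. (f x t \<bullet> \<phi> x) * \<xi> t))"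

text \<open>The weak formulation does not see $t=0$. The initial condition $v(\cdot,0)=v_0$ is imposed
  as an essential limit, tested against smooth fields; as \<^term>\<open>v\<close> is bounded in $L^2$, this is
  weak convergence in $L^2$. The infimum with \<^term>\<open>ae_filter lebesgue\<close> makes the limit
  essential, that is, exceptional null sets are ignored.\<close>

definition attains_initial_datum ::
    "(real^'n::finite \<Rightarrow> real \<Rightarrow> real^'n) \<Rightarrow> (real^'n \<Rightarrow> real^'n) \<Rightarrow> bool" where
  "attains_initial_datum v v0 \<longleftrightarrow> (\<forall>\<phi>\<in>test_fields.
     ((\<lambda>t. LINT x|lebesgue. v x t \<bullet> \<phi> x) \<longlongrightarrow> (LINT x|lebesgue. v0 x \<bullet> \<phi> x))
       (inf (at_right 0) (ae_filter lebesgue)))"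

definition Leray_weak_solution :: "real \<Rightarrow> real \<Rightarrow> (real^'n::finite \<Rightarrow> real \<Rightarrow> real^'n) \<Rightarrow>
    (real^'n \<Rightarrow> real^'n) \<Rightarrow> (real^'n \<Rightarrow> real \<Rightarrow> real^'n) \<Rightarrow> (real^'n \<Rightarrow> real \<Rightarrow> real) \<Rightarrow> bool" where
  "Leray_weak_solution \<nu> T f v0 v p \<longleftrightarrow>
     NS_weak_solution \<nu> T f v p \<and>
     v \<in> time_Lq \<infinity> T {Lq_norm 2 lebesgue} (Lq_sigma 2) \<and>
     v \<in> time_Lq 2 T {H1_norm} H1_sigma \<and>
     v0 \<in> Lq_sigma 2 \<and> attains_initial_datum v v0 \<and>
     (AE t in lebesgue_on {0<..<T}.
        1/2 * (Lq_norm 2 lebesgue (\<lambda>x. v x t))\<^sup>2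
        + \<nu> * (LINT s:{0<..<t}|lebesgue. (Lq_norm 2 lebesgue (weak_grad (\<lambda>x. v x s)))\<^sup>2)
        \<le> 1/2 * (Lq_norm 2 lebesgue v0)\<^sup>2
        + (LINT s:{0<..<t}|lebesgue. LINT x|lebesgue. f x s \<bullet> v x s))"

text \<open>Vanishing as $|x|\to\infty$ for a function defined up to null sets.\<close>

definition ess_vanishes_at_infinity :: "(real^'n::finite \<Rightarrow> real) \<Rightarrow> bool" where
  "ess_vanishes_at_infinity g \<longleftrightarrow> (g \<longlongrightarrow> 0) (inf at_infinity (ae_filter lebesgue))"

definition pressure_weight :: "(real \<Rightarrow> real) \<Rightarrow> real^'n::finite \<Rightarrow> real" where
  "pressure_weight w x =
     w (norm x) + (real CARD('n) - 1) / norm x * (LINT s:{0..norm x}|lebesgue. w s)"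

end

theory Submission
  imports Defs
begin

text \<open>
  Let \<open>W\<close> be the primitive of \<open>w\<close> with \<open>W(0) = 0\<close>, and let \<open>\<psi>\<close> be the radial potential with radial
  derivative \<open>W(|x|)\<close>. Its Hessian has the eigenvalue \<open>w(|x|)\<close> in the radial direction and \<open>W(|x|)/|x|\<close>
  in the tangential directions, all positive, and its Laplacian is the weight of the pressure condition.
  Testing the system with \<open>\<nabla>\<psi>\<close> removes the time derivative, the viscous term and the force, because
  \<open>v\<close> and \<open>f\<close> are solenoidal and both \<open>\<nabla>\<psi>\<close> and \<open>\<Delta>\<nabla>\<psi>\<close> are gradients. What remains at almost every time is
  \<open>\<integral> (v \<otimes> v) : \<nabla>\<^sup>2\<psi> dx = - \<integral> p \<Delta>\<psi> dx\<close>. The right-hand side is nonpositive by hypothesis and the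
  integrand on the left is positive wherever \<open>v\<close> does not vanish. So \<open>v = 0\<close>.

  This \<open>\<psi>\<close> is neither smooth nor compactly supported, so it has to be approximated. As a function of
  \<open>s = |x|\<^sup>2\<close> it has a derivative \<open>k\<close> with \<open>2 k(r\<^sup>2) = W(r)/r\<close>. If \<open>w(r) = q(r\<^sup>2)\<close> with a polynomial
  \<open>q\<close>, then \<open>k\<close> is the polynomial \<open>K\<close> with \<open>2 K + 4 s K' = q\<close> (\<open>exists_averaging_poly\<close>,
  \<open>averaging_poly_integral\<close>), and \<open>K\<close> times a smooth cutoff comes from a genuine test function
  (\<open>radial_test_function\<close>). The bounded measurable \<open>w\<close> is an almost everywhere limit of such
  polynomials (\<open>polynomials_converge_AE\<close>), and the identity for \<open>2 K + 4 s K'\<close> means that no derivative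
  of the approximations needs to converge.

  The pressure equation holds outside a null set of times that depends on the test function
  (\<open>pressure_equation_slice\<close>); only a sequence of polynomials and a sequence of cutoff radii occur, so one
  null set suffices. For a fixed time, \<open>vanishing_from_balance\<close> first lets the polynomials converge and
  then lets the radius tend to infinity. In the second limit the errors of the cutoff are of size
  \<open>|p| W(|x|)/|x|\<close>, and since the dimension is at least two this is at most \<open>|p|\<close> times the weight, which is
  integrable.
\<close>

section \<open>Flat functions\<close>

text \<open>The derivative of a member is a combination of later members, also at the origin: that
  makes every member smooth without computing higher derivatives, and the members of index 0 serve
  as cutoffs.\<close>

definition flat :: "nat \<Rightarrow> real \<Rightarrow> real" where
  "flat m y = (if 0 < y then exp (- 1 / y) / y ^ m else 0)"

lemma flat_nonneg: "0 \<le> flat m y"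
  by (simp add: flat_def)

lemma flat_tendsto_0: "(flat m \<longlongrightarrow> 0) (at 0)"
proof (rule filterlim_split_at)
  show "(flat m \<longlongrightarrow> 0) (at_left 0)"
    by (rule tendsto_eventually) (auto simp: flat_def eventually_at_filter)
  have "((\<lambda>y::real. inverse y ^ m / exp (inverse y)) \<longlongrightarrow> 0) (at_right 0)"
    by (rule filterlim_compose[OF tendsto_power_div_exp_0 filterlim_inverse_at_top_right])
  then show "(flat m \<longlongrightarrow> 0) (at_right 0)"
    by (rule tendsto_cong[THEN iffD1, rotated])
       (auto simp: flat_def eventually_at_filter exp_minus field_simps)
qed

text \<open>At the origin the difference quotient of a member is the next member, so
  differentiability there is the same limit as continuity.\<close>

lemma flat_has_real_derivative:
  "(flat m has_real_derivative flat (m + 2) y - real m * flat (m + 1) y) (at y)"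
proof -
  consider "y > 0" | "y < 0" | "y = 0" by linarith
  then show ?thesis
  proof cases
    case 1
    have m: "real m * y ^ (m - Suc 0) = real m * y ^ m / y"
      using 1 by (cases m) auto
    have "((\<lambda>y. exp (- 1 / y) / y ^ m) has_real_derivative flat (m + 2) y - real m * flat (m + 1) y) (at y)"
      using 1 by (auto intro!: derivative_eq_intros simp: m flat_def field_simps power2_eq_square)
    then show ?thesis
      by (rule DERIV_cong_ev[THEN iffD1, rotated -1])
         (use 1 in \<open>auto simp: flat_def eventually_nhds intro!: exI[of _ "{0<..}"]\<close>)
  next
    case 2
    have "((\<lambda>y. 0) has_real_derivative flat (m + 2) y - real m * flat (m + 1) y) (at y)"
      using 2 by (auto simp: flat_def)
    then show ?thesis
      by (rule DERIV_cong_ev[THEN iffD1, rotated -1])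
         (use 2 in \<open>auto simp: flat_def eventually_nhds intro!: exI[of _ "{..<0}"]\<close>)
  next
    case 3
    have "(\<lambda>h. (flat m (0 + h) - flat m 0) / h) = flat (m + 1)"
      by (auto simp: flat_def fun_eq_iff)
    then have "(flat m has_real_derivative 0) (at 0)"
      using flat_tendsto_0[of "m + 1"] by (simp add: DERIV_def)
    then show ?thesis using 3 by (simp add: flat_def)
  qed
qed

lemma flat_continuous: "continuous_on UNIV (flat m)"
  using flat_has_real_derivative[THEN DERIV_isCont] by (auto intro!: continuous_at_imp_continuous_on)

lemma flat_affine_derivative:
  "((\<lambda>s. flat m (1 - c * s)) has_real_derivative
      (flat (m + 2) (1 - c * s) - real m * flat (m + 1) (1 - c * s)) * (- c)) (at s)"
  by (rule DERIV_chain2[OF flat_has_real_derivative]) (auto intro!: derivative_eq_intros)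

text \<open>From the quadratic Taylor bound \<open>exp z \<ge> z\<^sup>2 / 2\<close> at \<open>z =
  1 / y\<close>. It controls the derivative of the cutoff uniformly in the radius.\<close>

lemma flat_2_le: "flat 2 y \<le> 2"
proof (cases "y > 0")
  case True
  have "(1 / y)\<^sup>2 / 2 \<le> exp (1 / y)"
  proof -
    have "0 < 1 / y" using True by simp
    then show ?thesis using exp_lower_Taylor_quadratic[of "1 / y"] by linarith
  qed
  then show ?thesis using True
    by (simp add: flat_def exp_minus power_divide field_simps)
qed (simp add: flat_def)

lemma flat_0_le: "flat 0 y \<le> 1"
  by (simp add: flat_def)

section \<open>A differentially closed algebra of functions\<close>

lemma pderiv_at_eqI: "(g has_derivative g') (at x) \<Longrightarrow> pderiv_at i g x = g' (axis i 1)"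
  unfolding pderiv_at_def by (metis frechet_derivative_at)

text \<open>An algebra of functions stable under partial derivatives. Membership is preserved by
  differentiation, so it gives all orders of smoothness at once.\<close>

inductive smooth_algebra :: "real \<Rightarrow> (real^'n::finite \<Rightarrow> real) \<Rightarrow> bool" for c where
  const: "smooth_algebra c (\<lambda>x. a)"
| coord: "smooth_algebra c (\<lambda>x. x $ i)"
| bump: "smooth_algebra c (\<lambda>x. flat m (1 - c * (x \<bullet> x)))"
| add: "smooth_algebra c f \<Longrightarrow> smooth_algebra c g \<Longrightarrow> smooth_algebra c (\<lambda>x. f x + g x)"
| mult: "smooth_algebra c f \<Longrightarrow> smooth_algebra c g \<Longrightarrow> smooth_algebra c (\<lambda>x. f x * g x)"

lemma smooth_algebra_sum: "(\<And>j. j \<in> J \<Longrightarrow> smooth_algebra c (f j)) \<Longrightarrow> smooth_algebra c (\<lambda>x. \<Sum>j\<in>J. f j x)"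
  by (induction J rule: infinite_finite_induct) (auto intro: smooth_algebra.intros)

lemma smooth_algebra_inner: "smooth_algebra c (\<lambda>x::real^'n::finite. x \<bullet> x)"
  unfolding inner_vec_def by (auto intro!: smooth_algebra_sum smooth_algebra.intros)

lemma smooth_algebra_poly: "smooth_algebra c (\<lambda>x::real^'n::finite. poly K (x \<bullet> x))"
  by (induction K) (auto intro!: smooth_algebra.intros smooth_algebra_inner)

lemma radial_has_derivative:
  fixes x :: "'a::real_inner"
  assumes "(A has_real_derivative a) (at (x \<bullet> x))"
  shows "((\<lambda>x. A (x \<bullet> x)) has_derivative (\<lambda>h. a * (2 * (x \<bullet> h)))) (at x)"
proof -
  have "((\<lambda>x. x \<bullet> x) has_derivative (\<lambda>h. x \<bullet> h + h \<bullet> x)) (at x)"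
    by (intro has_derivative_inner has_derivative_ident)
  then have 1: "((\<lambda>x. x \<bullet> x) has_derivative (\<lambda>h. 2 * (x \<bullet> h))) (at x)"
    by (simp add: inner_commute)
  show ?thesis
    using has_derivative_compose[OF 1 assms[unfolded has_field_derivative_def]] by simp
qed

lemma smooth_algebra_derivative:
  assumes "smooth_algebra c (f :: real^'n::finite \<Rightarrow> real)"
  shows "\<exists>D. (\<forall>x. (f has_derivative D x) (at x)) \<and> (\<forall>i. smooth_algebra c (\<lambda>x. D x (axis i 1)))"
  using assms
proof induction
  case (const a)
  show ?case by (rule exI[of _ "\<lambda>x h. 0"]) (auto intro: smooth_algebra.intros)
next
  case (coord i)
  have "\<forall>x::real^'n. ((\<lambda>x. x $ i) has_derivative (\<lambda>h. h $ i)) (at x)"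
    by (intro allI bounded_linear_imp_has_derivative bounded_linear_vec_nth)
  then show ?case
    by (intro exI[of _ "\<lambda>x h. h $ i"]) (auto intro: smooth_algebra.intros)
next
  case (bump m)
  have "smooth_algebra c (\<lambda>x::real^'n. (flat (m + 2) (1 - c * (x \<bullet> x)) + (- real m) * flat (m + 1) (1 - c * (x \<bullet> x)))
       * (- c) * (2 * x $ i))" for i
    by (intro smooth_algebra.intros)
  then show ?case
    by (intro exI[of _ "\<lambda>x h. (flat (m + 2) (1 - c * (x \<bullet> x)) - real m * flat (m + 1) (1 - c * (x \<bullet> x)))
       * (- c) * (2 * (x \<bullet> h))"] conjI allI radial_has_derivative flat_affine_derivative)
     (simp add: inner_axis)
next
  case (add f g)
  then obtain D E where
    "\<forall>x. (f has_derivative D x) (at x)" "\<forall>i. smooth_algebra c (\<lambda>x. D x (axis i 1))"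
    "\<forall>x. (g has_derivative E x) (at x)" "\<forall>i. smooth_algebra c (\<lambda>x. E x (axis i 1))" by blast
  then show ?case
    by (intro exI[of _ "\<lambda>x h. D x h + E x h"]) (auto intro!: smooth_algebra.intros has_derivative_add)
next
  case (mult f g)
  then obtain D E where
    "\<forall>x. (f has_derivative D x) (at x)" "\<forall>i. smooth_algebra c (\<lambda>x. D x (axis i 1))"
    "\<forall>x. (g has_derivative E x) (at x)" "\<forall>i. smooth_algebra c (\<lambda>x. E x (axis i 1))" by blast
  then show ?case using mult
    by (intro exI[of _ "\<lambda>x h. f x * E x h + D x h * g x"]) (auto intro!: smooth_algebra.intros has_derivative_mult)
qed

lemma smooth_algebra_Ck:
  assumes "smooth_algebra c (f :: real^'n::finite \<Rightarrow> real)"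
  shows "Ck k f"
  using assms
proof (induction k arbitrary: f)
  case 0
  then obtain D where "\<forall>x. (f has_derivative D x) (at x)" using smooth_algebra_derivative by blast
  then show ?case
    by (auto intro!: continuous_at_imp_continuous_on has_derivative_continuous)
next
  case (Suc k)
  obtain D where D: "\<forall>x. (f has_derivative D x) (at x)" "\<forall>i. smooth_algebra c (\<lambda>x. D x (axis i 1))"
    using smooth_algebra_derivative[OF Suc.prems] by blast
  have "pderiv_at i f = (\<lambda>x. D x (axis i 1))" for i
    using D(1) by (intro ext pderiv_at_eqI) auto
  with D Suc.IH show ?case by (auto simp: differentiable_def)
qed

lemma test_functionsI:
  assumes "\<And>k. Ck k f" and "\<And>x. R \<le> norm x \<Longrightarrow> f x = 0"
  shows "f \<in> test_functions"
proof -
  have "{x. f x \<noteq> 0} \<subseteq> cball 0 R"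
    using assms(2) by (force simp: not_le)
  then have "bounded {x. f x \<noteq> 0}" using bounded_cball bounded_subset by blast
  then show ?thesis using assms(1) by (auto simp: test_functions_def)
qed

section \<open>Radial test functions\<close>

text \<open>The profile \<open>cutoff K c\<close>, as a function of \<open>s =
  |x|\<^sup>2\<close>, is a polynomial restricted smoothly to \<open>s \<le> 1 / c\<close>;
  \<open>cutoff1\<close> and \<open>cutoff2\<close> are its first two derivatives. The cutoff
  equals \<open>exp (- 1)\<close> at the origin rather than 1; a constant factor is harmless
  because the pressure equation is linear in the potential.\<close>

definition cutoff :: "real poly \<Rightarrow> real \<Rightarrow> real \<Rightarrow> real" where
  "cutoff K c s = poly K s * flat 0 (1 - c * s)"

definition cutoff1 :: "real poly \<Rightarrow> real \<Rightarrow> real \<Rightarrow> real" where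
  "cutoff1 K c s = poly (pderiv K) s * flat 0 (1 - c * s) + poly K s * (- c) * flat 2 (1 - c * s)"

definition cutoff2 :: "real poly \<Rightarrow> real \<Rightarrow> real \<Rightarrow> real" where
  "cutoff2 K c s = poly (pderiv (pderiv K)) s * flat 0 (1 - c * s)
     + 2 * (poly (pderiv K) s * (- c) * flat 2 (1 - c * s))
     + poly K s * (c * c) * (flat 4 (1 - c * s) - 2 * flat 3 (1 - c * s))"

lemma cutoff_derivative: "(cutoff K c has_real_derivative cutoff1 K c s) (at s)"
  unfolding cutoff_def cutoff1_def
  by (rule derivative_eq_intros poly_DERIV flat_affine_derivative refl)+
    (simp add: algebra_simps eval_nat_numeral)

lemma cutoff1_derivative: "(cutoff1 K c has_real_derivative cutoff2 K c s) (at s)"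
  unfolding cutoff1_def cutoff2_def
  by (rule derivative_eq_intros poly_DERIV flat_affine_derivative refl)+ 
    (simp add: algebra_simps eval_nat_numeral)

lemma cutoff_eq_0: "1 \<le> c * s \<Longrightarrow> cutoff K c s = 0" "1 \<le> c * s \<Longrightarrow> cutoff1 K c s = 0"
  by (auto simp: cutoff_def cutoff1_def flat_def)

lemma smooth_algebra_cutoff:
  "smooth_algebra c (\<lambda>x::real^'n::finite. cutoff K c (x \<bullet> x))"
  "smooth_algebra c (\<lambda>x::real^'n::finite. cutoff1 K c (x \<bullet> x))"
  unfolding cutoff_def cutoff1_def by (intro smooth_algebra.intros smooth_algebra_poly)+

text \<open>The potential is the primitive of the profile that vanishes for large
  \<open>s\<close>. The integration starts at \<open>- 1\<close> so that the derivative at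
  \<open>s = 0\<close> is two-sided.\<close>

lemma antiderivative_vanishing:
  fixes a0 :: "real \<Rightarrow> real"
  assumes cont: "continuous_on UNIV a0" and "0 \<le> b" and z: "\<And>s. b \<le> s \<Longrightarrow> a0 s = 0"
  obtains H where "\<And>s. 0 \<le> s \<Longrightarrow> (H has_real_derivative a0 s) (at s)" "\<And>s. b \<le> s \<Longrightarrow> H s = 0"
proof
  define H where "H s = integral {-1..s} a0 - integral {-1..b} a0" for s
  show "(H has_real_derivative a0 s) (at s)" if "0 \<le> s" for s
  proof -
    have "((\<lambda>u. integral {-1..u} a0) has_real_derivative a0 s) (at s within {-1..s+1})"
      using that by (intro integral_has_real_derivative[OF continuous_on_subset[OF cont]]) auto
    then have "((\<lambda>u. integral {-1..u} a0) has_real_derivative a0 s) (at s)"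
      using that by (subst (asm) at_within_interior) auto
    then show ?thesis unfolding H_def by (auto intro!: derivative_eq_intros)
  qed
  show "H s = 0" if "b \<le> s" for s
  proof -
    have "integral {-1..b} a0 + integral {b..s} a0 = integral {-1..s} a0"
      by (rule Henstock_Kurzweil_Integration.integral_combine)
        (use that assms(2) in \<open>auto intro!: integrable_continuous_real continuous_on_subset[OF cont]\<close>)
    moreover have "integral {b..s} a0 = integral {b..s} (\<lambda>_. 0)"
      by (rule integral_cong) (use z in auto)
    ultimately show ?thesis by (simp add: H_def)
  qed
qed

lemma radial_coord_has_derivative:
  fixes x :: "real^'n::finite"
  assumes "(A has_real_derivative a) (at (x \<bullet> x))"
  shows "((\<lambda>x. x $ j * A (x \<bullet> x)) has_derivative (\<lambda>h. x $ j * (a * (2 * (x \<bullet> h))) + h $ j * A (x \<bullet> x))) (at x)"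
  by (intro has_derivative_mult radial_has_derivative assms bounded_linear_imp_has_derivative bounded_linear_vec_nth)

lemma one_le_outside_ball:
  fixes x :: "'a::real_inner"
  assumes "0 < c" "1 / sqrt c \<le> norm x"
  shows "1 \<le> c * (x \<bullet> x)"
proof -
  have "1 \<le> sqrt c * norm x" using assms by (simp add: field_simps)
  then have "1\<^sup>2 \<le> (sqrt c * norm x)\<^sup>2" by (intro power_mono) auto
  then show ?thesis using assms(1) by (simp add: power_mult_distrib dot_square_norm)
qed

text \<open>Take \<open>\<psi> x = H (|x|\<^sup>2)\<close> with \<open>H\<close> a primitive of
  the profile. Then \<open>\<nabla>\<psi> = 2 x H'(|x|\<^sup>2)\<close>, and all derivatives up to
  order three are explicit and symmetric in their indices; hence
  \<open>\<Delta>\<nabla>\<psi>\<close> is again a gradient, which is what makes the viscous term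
  drop out against a solenoidal field.\<close>

lemma radial_test_function:
  fixes K :: "real poly" and c :: real
  assumes c: "0 < c"
  defines "hess \<equiv> \<lambda>(x::real^'n::finite) i j.
      4 * (x $ i * x $ j) * cutoff1 K c (x \<bullet> x) + (if i = j then 2 * cutoff K c (x \<bullet> x) else 0)"
  obtains \<psi> :: "real^'n::finite \<Rightarrow> real" and \<Delta> :: "real^'n \<Rightarrow> real" where
    "\<psi> \<in> test_functions" "\<Delta> \<in> test_functions" "grad \<psi> \<in> test_fields"
    "\<And>x i j. grad_field (grad \<psi>) x $ i $ j = hess x i j"
    "\<And>x. divergence (grad \<psi>) x = \<Delta> x"
    "laplacian_field (grad \<psi>) = grad \<Delta>"
    "\<And>x. \<Delta> x = 4 * (x \<bullet> x) * cutoff1 K c (x \<bullet> x) + 2 * real CARD('n) * cutoff K c (x \<bullet> x)"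
proof -
  define a0 a1 a2 where a: "a0 = cutoff K c" "a1 = cutoff1 K c" "a2 = cutoff2 K c"
  have d0: "(a0 has_real_derivative a1 s) (at s)" for s by (simp add: a cutoff_derivative)
  have d1: "(a1 has_real_derivative a2 s) (at s)" for s by (simp add: a cutoff1_derivative)
  define R where "R = 1 / sqrt c"
  have R: "1 \<le> c * (x \<bullet> x)" if "R \<le> norm x" for x :: "real^'n"
    using one_le_outside_ball[OF c] that by (simp add: R_def)
  have "continuous_on UNIV a0"
    using d0 by (auto intro!: continuous_at_imp_continuous_on DERIV_isCont)
  moreover have "a0 s = 0" if "1 / c \<le> s" for s using that c by (simp add: a cutoff_eq_0 field_simps)
  ultimately obtain H
    where H: "\<And>s. 0 \<le> s \<Longrightarrow> (H has_real_derivative a0 s) (at s)" "\<And>s. 1 / c \<le> s \<Longrightarrow> H s = 0"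
    using c antiderivative_vanishing[of a0 "1 / c"] by auto
  define \<psi> :: "real^'n \<Rightarrow> real" where "\<psi> x = H (x \<bullet> x)" for x
  have d\<psi>: "(\<psi> has_derivative (\<lambda>h. a0 (x \<bullet> x) * (2 * (x \<bullet> h)))) (at x)" for x
    unfolding \<psi>_def by (intro radial_has_derivative H) simp
  have p\<psi>: "pderiv_at i \<psi> = (\<lambda>x. 2 * (x $ i * a0 (x \<bullet> x)))" for i
    by (rule ext) (simp add: pderiv_at_eqI[OF d\<psi>] inner_axis)
  have s\<psi>: "smooth_algebra c (pderiv_at i \<psi>)" for i
    unfolding p\<psi> a by (intro smooth_algebra.intros smooth_algebra_cutoff)
  have dj: "((\<lambda>x. 2 * (x $ j * a0 (x \<bullet> x))) has_derivative 
      (\<lambda>h. 2 * (x $ j * (a1 (x \<bullet> x) * (2 * (x \<bullet> h))) + h $ j * a0 (x \<bullet> x)))) (at x)" for x :: "real^'n" and j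
    by (intro has_derivative_mult_right radial_coord_has_derivative d0)
  have pp\<psi>: "pderiv_at i (pderiv_at j \<psi>) =
     (\<lambda>x. 4 * (x $ i * (x $ j * a1 (x \<bullet> x))) + (if i = j then 2 else 0) * a0 (x \<bullet> x))" for i j
    unfolding p\<psi> by (rule ext) (auto simp: pderiv_at_eqI[OF dj] inner_axis, auto simp: axis_def)
  have pppd: "((\<lambda>x. 4 * (x $ i * (x $ j * a1 (x \<bullet> x))) + e * a0 (x \<bullet> x))
     has_derivative (\<lambda>h. 4 * (x $ i * (x $ j * (a2 (x \<bullet> x) * (2 * (x \<bullet> h))) + h $ j * a1 (x \<bullet> x)) +
           h $ i * (x $ j * a1 (x \<bullet> x))) + e * (a1 (x \<bullet> x) * (2 * (x \<bullet> h))))) (at x)"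
     for x :: "real^'n" and i j e
    by (rule has_derivative_add[OF has_derivative_mult_right[OF has_derivative_mult[OF
          bounded_linear_imp_has_derivative[OF bounded_linear_vec_nth] radial_coord_has_derivative[OF d1]]]
          has_derivative_mult_right[OF radial_has_derivative[OF d0]]])
  have ppp\<psi>: "pderiv_at i (pderiv_at i (pderiv_at j \<psi>)) x =
     8 * (x $ i * x $ i) * (x $ j * a2 (x \<bullet> x)) + 4 * (x $ j * a1 (x \<bullet> x)) + (if i = j then 8 * x $ j * a1 (x \<bullet> x) else 0)" for i j x
    unfolding pp\<psi> pderiv_at_eqI[OF pppd] by (simp add: inner_axis, auto simp: axis_def algebra_simps)
  define \<Delta> :: "real^'n \<Rightarrow> real"
    where "\<Delta> x = 4 * ((x \<bullet> x) * a1 (x \<bullet> x)) + 2 * real CARD('n) * a0 (x \<bullet> x)" for x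
  have s\<Delta>: "smooth_algebra c \<Delta>"
    unfolding \<Delta>_def a by (intro smooth_algebra.intros smooth_algebra_inner smooth_algebra_cutoff)
  have d\<Delta>: "(\<Delta> has_derivative (\<lambda>h. 4 * ((x \<bullet> x) * (a2 (x \<bullet> x) * (2 * (x \<bullet> h))) + 1 * (2 * (x \<bullet> h)) * a1 (x \<bullet> x))
      + 2 * real CARD('n) * (a1 (x \<bullet> x) * (2 * (x \<bullet> h))))) (at x)" for x
    unfolding \<Delta>_def
    by (rule has_derivative_add[OF has_derivative_mult_right[OF has_derivative_mult[OF
          radial_has_derivative[of "\<lambda>s. s", OF DERIV_ident] radial_has_derivative[OF d1]]]
          has_derivative_mult_right[OF radial_has_derivative[OF d0]]])
  have g\<psi>: "(\<lambda>y. grad \<psi> y $ j) = pderiv_at j \<psi>" for j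
    by (simp add: grad_def)
  show thesis
  proof (rule that[of \<psi> \<Delta>])
    show "\<psi> \<in> test_functions"
    proof (rule test_functionsI[of _ R])
      have "\<And>x. \<psi> differentiable at x" using d\<psi> by (auto simp: differentiable_def)
      moreover have "Ck 0 \<psi>" using d\<psi> 
        by (auto intro!: continuous_at_imp_continuous_on has_derivative_continuous)
      ultimately show "Ck k \<psi>" for k
        using smooth_algebra_Ck[OF s\<psi>] by (cases k) auto
      show "\<psi> x = 0" if "R \<le> norm x" for x
        using R[OF that] c by (simp add: \<psi>_def H field_simps)
    qed
    show "\<Delta> \<in> test_functions"
      using smooth_algebra_Ck[OF s\<Delta>]
      by (rule test_functionsI[of _ R]) (use R in \<open>simp add: \<Delta>_def a cutoff_eq_0\<close>)
    have "pderiv_at j \<psi> \<in> test_functions" for j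
      using smooth_algebra_Ck[OF s\<psi>]
      by (rule test_functionsI[of _ R]) (use R in \<open>simp add: p\<psi> a cutoff_eq_0\<close>)
    then show "grad \<psi> \<in> test_fields" by (simp add: test_fields_def g\<psi>)
    show "grad_field (grad \<psi>) x $ i $ j = hess x i j" for x i j
      by (simp add: grad_field_def g\<psi> pp\<psi> hess_def a)
    show "divergence (grad \<psi>) x = \<Delta> x" for x
      by (simp add: divergence_def g\<psi> pp\<psi> \<Delta>_def sum.distrib sum_distrib_left sum_distrib_right inner_vec_def algebra_simps)
    show "\<Delta> x = 4 * (x \<bullet> x) * cutoff1 K c (x \<bullet> x) + 2 * real CARD('n) * cutoff K c (x \<bullet> x)" for x
      by (simp add: \<Delta>_def a)
    show "laplacian_field (grad \<psi>) = grad \<Delta>"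
    proof (rule ext, rule vec_eq_iff[THEN iffD2], rule allI)
      fix x j
      have "laplacian_field (grad \<psi>) x $ j = (\<Sum>i\<in>UNIV. x $ i * x $ i) * (8 * x $ j * a2 (x \<bullet> x))
         + real CARD('n) * (4 * x $ j * a1 (x \<bullet> x)) + 8 * x $ j * a1 (x \<bullet> x)"
        by (simp add: laplacian_field_def g\<psi> ppp\<psi> sum.distrib sum_distrib_left sum_distrib_right algebra_simps)
      also have "(\<Sum>i\<in>UNIV. x $ i * x $ i) = x \<bullet> x" by (simp add: inner_vec_def)
      also have "(x \<bullet> x) * (8 * x $ j * a2 (x \<bullet> x))
         + real CARD('n) * (4 * x $ j * a1 (x \<bullet> x)) + 8 * x $ j * a1 (x \<bullet> x) = grad \<Delta> x $ j"
        by (simp add: grad_def pderiv_at_eqI[OF d\<Delta>] inner_axis algebra_simps)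
      finally show "laplacian_field (grad \<psi>) x $ j = grad \<Delta> x $ j" .
    qed
  qed
qed

section \<open>Radial null sets and polynomial approximation\<close>

lemma sets_lborel_pair:
  "sets (lborel \<Otimes>\<^sub>M lborel :: ('a::euclidean_space \<times> 'b::euclidean_space) measure) = sets borel"
  unfolding lborel_prod by simp

text \<open>If \<open>N\<close> is null, then for every \<open>x \<noteq> 0\<close> almost every
  dilation factor \<open>l\<close> has \<open>l |x| \<notin> N\<close>. By Fubini some \<open>l >
  0\<close> works for almost every \<open>x\<close>, and a dilation maps null sets to null sets.
  This replaces polar coordinates.\<close>

lemma AE_norm:
  assumes "AE r in lebesgue. P (r::real)"
  shows "AE x in lebesgue. P (norm (x::'a::euclidean_space))"
proof -
  obtain N where N: "N \<in> null_sets lborel" "\<And>r. r \<notin> N \<Longrightarrow> P r"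
    using assms unfolding AE_completion_iff by (elim AE_E3) auto
  have [measurable]: "N \<in> sets borel" using N(1) by auto
  have "AE x in lborel. AE l in lborel. l * norm (x::'a) \<notin> N"
    using AE_lborel_singleton[of "0::'a"]
  proof eventually_elim
    fix x :: 'a assume "x \<noteq> 0"
    moreover have "AE r in lborel. r \<notin> N" using N(1) by (rule AE_not_in)
    ultimately have "AE l in lborel. 0 + norm x * l \<notin> N"
      by (intro AE_borel_affine) auto
    then show "AE l in lborel. l * norm x \<notin> N" by (simp add: mult.commute)
  qed
  then have "AE l in lborel. AE x in lborel. l * norm (x::'a) \<notin> N"
    by (subst lborel_pair.AE_commute[symmetric]) measurable
  then obtain M where M: "M \<in> null_sets lborel"
    "\<And>l. l \<notin> M \<Longrightarrow> AE x in lborel. l * norm (x::'a) \<notin> N"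
    by (elim AE_E3) auto
  have "\<not> {0<..<1} \<subseteq> M"
  proof
    assume "{0<..<1} \<subseteq> M"
    then have "emeasure lborel {0<..<1::real} \<le> emeasure lborel M"
      using M(1) by (intro emeasure_mono) auto
    then show False using M(1) by (simp add: null_sets_def)
  qed
  then obtain l where "0 < l" "l \<notin> M" unfolding subset_eq by auto
  then have l: "0 < l" "AE x in lborel. l * norm (x::'a) \<notin> N" using M(2) by auto
  have "negligible {x::'a. l * norm x \<in> N}"
    using AE_completion[OF l(2)] by (simp add: negligible_iff_null_sets completion.AE_iff_null_sets)
  then have "negligible ((\<lambda>x. l *\<^sub>R x) ` {x::'a. l * norm x \<in> N})"
    by (intro negligible_differentiable_image_negligible) (auto intro!: derivative_intros)
  moreover have "{x::'a. norm x \<in> N} \<subseteq> (\<lambda>x. l *\<^sub>R x) ` {x::'a. l * norm x \<in> N}"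
  proof
    fix x :: 'a assume "x \<in> {x. norm x \<in> N}"
    then show "x \<in> (\<lambda>x. l *\<^sub>R x) ` {x::'a. l * norm x \<in> N}"
      using l(1) by (intro image_eqI[of _ _ "x /\<^sub>R l"]) (auto simp: mult.assoc[symmetric])
  qed
  ultimately have "negligible {x::'a. norm x \<in> N}" by (rule negligible_subset)
  then show ?thesis
    by (intro AE_I'[where N="{x::'a. norm x \<in> N}"]) (use N(2) in \<open>auto simp: negligible_iff_null_sets\<close>)
qed

lemma polynomial_approximation:
  fixes h :: "real \<Rightarrow> real"
  assumes "continuous_on {a..b} h" "0 < e"
  obtains q :: "real poly" where "\<And>s. s \<in> {a..b} \<Longrightarrow> \<bar>h s - poly q s\<bar> < e"
proof -
  obtain g where g: "real_polynomial_function g" "\<And>x. x \<in> {a..b} \<Longrightarrow> \<bar>h x - g x\<bar> < e"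
    using Stone_Weierstrass_real_polynomial_function[of "{a..b}" h e] assms by auto
  then obtain c n where "g = (\<lambda>x. \<Sum>i\<le>n. c i * x ^ i)"
    by (auto simp: real_polynomial_function_iff_sum)
  then have "g x = poly (\<Sum>i\<le>n. monom (c i) i) x" for x
    by (simp add: poly_sum poly_monom)
  with g that show ?thesis by metis
qed

text \<open>A measurable function is an almost everywhere limit of continuous ones (truncated here
  at \<open>C\<close>), and Weierstrass replaces these by polynomials on \<open>[- n, n]\<close>.
  The substitution \<open>\<rho>\<close> is there because radial profiles need polynomials in
  \<open>s = r\<^sup>2\<close>, with \<open>\<rho> = sqrt\<close>, while the time variable uses
  the identity.\<close>

lemma polynomials_converge_AE:
  fixes g \<rho> :: "real \<Rightarrow> real"
  assumes g: "g \<in> borel_measurable lebesgue" and C: "0 \<le> C" "AE r in lebesgue. \<bar>g r\<bar> \<le> C"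
    and \<rho>: "continuous_on UNIV \<rho>"
  obtains q :: "nat \<Rightarrow> real poly" where
    "\<And>n s. \<bar>s\<bar> \<le> real n \<Longrightarrow> \<bar>poly (q n) s\<bar> \<le> C + 1"
    "AE r in lebesgue. \<forall>s. \<rho> s = r \<longrightarrow> (\<lambda>n. poly (q n) s) \<longlonglongrightarrow> g r"
proof -
  obtain N G where N: "negligible N" and G: "\<And>n. continuous_on UNIV (G n)"
    "\<And>x. x \<notin> N \<Longrightarrow> (\<lambda>n. G n x) \<longlonglongrightarrow> g x"
    using g measurable_on_iff_borel_measurable[of UNIV g]
    by (auto simp: measurable_on_def lebesgue_on_UNIV_eq)
  define F where "F n x = max (- C) (min C (G n x))" for n x
  have F: "continuous_on UNIV (F n)" "\<bar>F n x\<bar> \<le> C" for n x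
    unfolding F_def using G(1) C(1) by (auto intro!: continuous_intros)
  have "\<exists>q. \<forall>s\<in>{- real n..real n}. \<bar>F n (\<rho> s) - poly q s\<bar> < 1 / real (Suc n)" for n
  proof -
    have "continuous_on {- real n..real n} (\<lambda>s. F n (\<rho> s))"
      by (rule continuous_on_compose2[OF F(1) continuous_on_subset[OF \<rho>]]) auto
    then show ?thesis
      using polynomial_approximation[of "- real n" "real n" "\<lambda>s. F n (\<rho> s)" "1 / real (Suc n)"]
      by (metis of_nat_0_less_iff zero_less_Suc zero_less_divide_1_iff)
  qed
  then obtain q where q: "\<And>n s. \<bar>s\<bar> \<le> real n \<Longrightarrow> \<bar>F n (\<rho> s) - poly (q n) s\<bar> < 1 / real (Suc n)"
    unfolding atLeastAtMost_iff Ball_def abs_le_iff by (metis minus_le_iff)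
  show thesis
  proof
    show "\<bar>poly (q n) s\<bar> \<le> C + 1" if "\<bar>s\<bar> \<le> real n" for n s
    proof -
      have "1 / real (Suc n) \<le> 1" by simp
      then show ?thesis using q[OF that] F(2)[of n "\<rho> s"] by linarith
    qed
    have "AE r in lebesgue. r \<notin> N"
      using N by (simp add: negligible_iff_null_sets AE_not_in)
    with C(2) show "AE r in lebesgue. \<forall>s. \<rho> s = r \<longrightarrow> (\<lambda>n. poly (q n) s) \<longlonglongrightarrow> g r"
    proof eventually_elim
      case (elim r)
      show ?case
      proof (intro allI impI)
        fix s assume s: "\<rho> s = r"
        have "(\<lambda>n. F n r) \<longlonglongrightarrow> max (- C) (min C (g r))"
          unfolding F_def by (intro tendsto_intros G elim)
        moreover have "max (- C) (min C (g r)) = g r" using elim by auto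
        ultimately have 1: "(\<lambda>n. F n r) \<longlonglongrightarrow> g r" by simp
        have "eventually (\<lambda>n. \<bar>s\<bar> \<le> real n) sequentially"
          using filterlim_real_sequentially by (simp add: filterlim_at_top)
        then have "eventually (\<lambda>n. norm (F n r - poly (q n) s) \<le> 1 / real (Suc n)) sequentially"
          by eventually_elim (use q s in \<open>auto simp: less_imp_le\<close>)
        then have "(\<lambda>n. F n r - poly (q n) s) \<longlonglongrightarrow> 0"
          by (rule Lim_null_comparison) (use LIMSEQ_inverse_real_of_nat in \<open>simp add: inverse_eq_divide\<close>)
        from tendsto_diff[OF 1 this] show "(\<lambda>n. poly (q n) s) \<longlonglongrightarrow> g r" by simp
      qed
    qed
  qed
qed

section \<open>Slices of a space-time strip\<close>

lemma AE_lebesgue_on_iff: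
  "S \<in> sets lebesgue \<Longrightarrow> (AE z in lebesgue_on S. P z) \<longleftrightarrow> (AE z in lborel. z \<in> S \<longrightarrow> P z)"
  by (simp add: AE_restrict_space_iff AE_completion_iff)

lemma strip_measurable: "UNIV \<times> {0<..<T::real} \<in> sets (lebesgue :: ('a::euclidean_space \<times> real) measure)"
  by (intro borel_open[THEN sets_completionI_sets[of _ lborel, simplified]] open_Times) auto

text \<open>Fubini needs a Borel representative; for it, equality almost everywhere passes to
  almost every slice.\<close>

lemma borel_slices:
  fixes G :: "'a::euclidean_space \<times> real \<Rightarrow> real"
  assumes G: "G \<in> borel_measurable (lebesgue_on (UNIV \<times> {0<..<T}))"
  obtains G' where "G' \<in> borel_measurable borel"
    "AE z in lborel. z \<in> UNIV \<times> {0<..<T} \<longrightarrow> G z = G' z"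
    "AE t in lborel. t \<in> {0<..<T} \<longrightarrow> (AE x in lborel. G (x, t) = G' (x, t))"
proof -
  have "(\<lambda>z. if z \<in> UNIV \<times> {0<..<T} then G z else 0) \<in> borel_measurable lebesgue"
    using G strip_measurable by (rule borel_measurable_if_I)
  then obtain G' where G': "G' \<in> borel_measurable lborel"
    "AE z in lborel. (if z \<in> UNIV \<times> {0<..<T} then G z else 0) = G' z"
    using completion_ex_borel_measurable_real by blast
  have 1: "AE z in lborel. z \<in> UNIV \<times> {0<..<T} \<longrightarrow> G z = G' z"
    using G'(2) by eventually_elim auto
  then obtain N where N: "N \<in> null_sets lborel" "\<And>z. z \<notin> N \<Longrightarrow> z \<in> UNIV \<times> {0<..<T} \<longrightarrow> G z = G' z"
    by (elim AE_E3) auto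
  have [measurable]: "N \<in> sets borel" using N(1) by auto
  have "AE z in lborel \<Otimes>\<^sub>M lborel. z \<notin> N"
    unfolding lborel_prod using N(1) by (rule AE_not_in)
  then have "AE x in lborel. AE t in lborel. (x, t) \<notin> N" by (rule lborel_pair.AE_pair)
  moreover have "{z \<in> space (lborel \<Otimes>\<^sub>M lborel). (fst z, snd z) \<notin> N} \<in> sets (lborel \<Otimes>\<^sub>M lborel)"
  proof -
    have "{z \<in> space (lborel \<Otimes>\<^sub>M lborel). (fst z, snd z) \<notin> N} = - N"
      by (auto simp: space_pair_measure)
    then show ?thesis unfolding sets_lborel_pair by simp
  qed
  ultimately have "AE t in lborel. AE x in lborel. (x, t) \<notin> N"
    by (subst lborel_pair.AE_commute[symmetric])
  then have "AE t in lborel. t \<in> {0<..<T} \<longrightarrow> (AE x in lborel. G (x, t) = G' (x, t))"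
  proof eventually_elim
    case (elim t)
    show ?case
    proof
      assume t: "t \<in> {0<..<T}"
      show "AE x in lborel. G (x, t) = G' (x, t)"
        using elim by eventually_elim (use N(2) t in auto)
    qed
  qed
  with G'(1) 1 show thesis using that by simp
qed

lemma slice_integral_measurable:
  fixes G :: "'a::euclidean_space \<times> real \<Rightarrow> real"
  assumes G: "G \<in> borel_measurable (lebesgue_on (UNIV \<times> {0<..<T}))"
  shows "(\<lambda>t. LINT x|lebesgue. G (x, t)) \<in> borel_measurable (lebesgue_on {0<..<T})"
proof -
  obtain G' where [measurable]: "G' \<in> borel_measurable borel" and
    G': "AE t in lborel. t \<in> {0<..<T} \<longrightarrow> (AE x in lborel. G (x, t) = G' (x, t))"
    using borel_slices[OF G] by blast
  have [measurable]: "(\<lambda>x. G' (x, t)) \<in> borel_measurable borel" for t by measurable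
  have "(\<lambda>t. LINT x|lborel. G' (x, t)) \<in> borel_measurable borel"
    by (rule lborel.borel_measurable_lebesgue_integral) (simp add: case_prod_beta' borel_prod, measurable)
  then have m: "(\<lambda>t. if t \<in> {0<..<T} then LINT x|lborel. G' (x, t) else 0) \<in> borel_measurable lebesgue"
    by (intro measurable_completion) measurable
  have "AE t in lborel. (if t \<in> {0<..<T} then LINT x|lborel. G' (x, t) else 0)
      = (if t \<in> {0<..<T} then LINT x|lebesgue. G (x, t) else 0)"
    using G'
  proof eventually_elim
    case (elim t)
    show ?case
    proof (cases "t \<in> {0<..<T}")
      case True
      then have ae: "AE x in lebesgue. G' (x, t) = G (x, t)"
        using elim by (auto simp: AE_completion_iff)
      have 1: "(\<lambda>x. G' (x, t)) \<in> borel_measurable lebesgue" by (intro measurable_completion) simp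
      have "(LINT x|lborel. G' (x, t)) = (LINT x|lebesgue. G' (x, t))"
        by (rule integral_completion[symmetric]) simp
      also have "\<dots> = (LINT x|lebesgue. G (x, t))"
        by (rule integral_cong_AE[OF 1 borel_measurable_AE[OF 1 ae] ae])
      finally show ?thesis by simp
    qed auto
  qed
  then have "(\<lambda>t. if t \<in> {0<..<T} then LINT x|lebesgue. G (x, t) else 0) \<in> borel_measurable lebesgue"
    by (intro borel_measurable_AE[OF m]) (simp add: AE_completion_iff)
  then show ?thesis by (rule borel_measurable_if_D)
qed

lemma AE_strip_from_slices:
  fixes G :: "'a::euclidean_space \<times> real \<Rightarrow> real"
  assumes G: "G \<in> borel_measurable (lebesgue_on (UNIV \<times> {0<..<T}))"
    and z: "AE t in lebesgue_on {0<..<T}. AE x in lebesgue. G (x, t) = 0"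
  shows "AE z in lebesgue_on (UNIV \<times> {0<..<T}). G z = 0"
proof -
  obtain G' where [measurable]: "G' \<in> borel_measurable borel" and
    GG': "AE z in lborel. z \<in> UNIV \<times> {0<..<T} \<longrightarrow> G z = G' z" and
    G': "AE t in lborel. t \<in> {0<..<T} \<longrightarrow> (AE x in lborel. G (x, t) = G' (x, t))"
    using borel_slices[OF G] by blast
  have "AE t in lborel. t \<in> {0<..<T} \<longrightarrow> (AE x in lborel. G (x, t) = 0)"
    using z by (simp add: AE_lebesgue_on_iff AE_completion_iff)
  with G' have "AE t in lborel. AE x in lborel. t \<in> {0<..<T} \<longrightarrow> G' (x, t) = 0"
  proof eventually_elim
    case (elim t)
    show ?case
    proof (cases "t \<in> {0<..<T}")
      case True
      then have "AE x in lborel. G (x, t) = G' (x, t)" "AE x in lborel. G (x, t) = 0" using elim by auto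
      then show ?thesis by eventually_elim auto
    qed auto
  qed
  moreover have S: "{z \<in> space (lborel \<Otimes>\<^sub>M lborel). snd z \<in> {0<..<T} \<longrightarrow> G' (fst z, snd z) = 0}
      \<in> sets (lborel \<Otimes>\<^sub>M lborel :: ('a \<times> real) measure)"
  proof -
    have [measurable]: "snd \<in> borel_measurable (borel :: ('a \<times> real) measure)"
      by (intro borel_measurable_continuous_onI continuous_intros)
    have "Measurable.pred borel (\<lambda>z. snd z \<in> {0<..<T} \<longrightarrow> G' z = 0)" by measurable
    then show ?thesis unfolding sets_lborel_pair by (simp add: space_pair_measure pred_def)
  qed
  ultimately have "AE x in lborel. AE t in lborel. t \<in> {0<..<T} \<longrightarrow> G' (x, t) = 0"
    by (subst lborel_pair.AE_commute)
  then have "AE z in lborel \<Otimes>\<^sub>M lborel. snd z \<in> {0<..<T} \<longrightarrow> G' z = 0"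
    using S by (subst (asm) lborel_pair.AE_pair_iff) auto
  then have "AE z in lborel. z \<in> UNIV \<times> {0<..<T} \<longrightarrow> G' z = 0"
    unfolding lborel_prod by (simp add: mem_Times_iff)
  with GG' have "AE z in lborel. z \<in> UNIV \<times> {0<..<T} \<longrightarrow> G z = 0"
    by eventually_elim auto
  then show ?thesis by (simp add: AE_lebesgue_on_iff strip_measurable)
qed

section \<open>Removing the test function in time\<close>

lemma integrable_times_bounded:
  fixes g h :: "'a \<Rightarrow> real"
  assumes "integrable M g" "h \<in> borel_measurable M" "AE x in M. \<bar>h x\<bar> \<le> B"
  shows "integrable M (\<lambda>x. g x * h x)"
proof (rule Bochner_Integration.integrable_bound[where f="\<lambda>x. B * g x"])
  show "integrable M (\<lambda>x. B * g x)" using assms(1) by simp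
  show "(\<lambda>x. g x * h x) \<in> borel_measurable M" using assms by simp
  show "AE x in M. norm (g x * h x) \<le> norm (B * g x)"
    using assms(3)
  proof eventually_elim
    case (elim x)
    then have "\<bar>g x\<bar> * \<bar>h x\<bar> \<le> \<bar>g x\<bar> * \<bar>B\<bar>" by (intro mult_left_mono) auto
    then show ?case by (simp add: abs_mult mult.commute)
  qed
qed

lemma sgn_measurable: "(sgn :: real \<Rightarrow> real) \<in> borel_measurable borel"
  unfolding sgn_real_def by measurable

text \<open>Test with \<open>b\<close> times polynomials that converge to \<open>sgn g\<close>,
  where \<open>b\<close> is a smooth bump positive exactly on \<open>]e, T - e[\<close>. Dominated
  convergence gives \<open>\<integral> |g| b = 0\<close>.\<close>

lemma orthogonal_to_time_tests_imp_AE_0: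
  fixes g :: "real \<Rightarrow> real"
  assumes g: "integrable (lebesgue_on {0<..<T}) g"
    and orth: "\<And>\<xi>. \<xi> \<in> time_tests T \<Longrightarrow> (LINT t|lebesgue_on {0<..<T}. g t * \<xi> t) = 0"
  shows "AE t in lebesgue_on {0<..<T}. g t = 0"
proof -
  \<comment> \<open>The sign is extended by 0 to the whole line, where the approximation lemma applies.\<close>
  define sg where "sg t = (if t \<in> {0<..<T} then sgn (g t) else 0)" for t
  have "(\<lambda>t. sgn (g t)) \<in> borel_measurable (lebesgue_on {0<..<T})"
    by (intro measurable_compose[OF borel_measurable_integrable[OF g]] sgn_measurable)
  then have "sg \<in> borel_measurable lebesgue"
    unfolding sg_def by (intro borel_measurable_if_I) auto
  then obtain q where q: "\<And>n s. \<bar>s\<bar> \<le> real n \<Longrightarrow> \<bar>poly (q n) s\<bar> \<le> 1 + 1"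
    "AE r in lebesgue. \<forall>s. s = r \<longrightarrow> (\<lambda>n. poly (q n) s) \<longlonglongrightarrow> sg r"
    by (rule polynomials_converge_AE[where C=1 and \<rho>="\<lambda>s. s"])
       (auto simp: sg_def sgn_real_def intro!: continuous_intros)
  have "AE t in lebesgue_on {0<..<T}. e < t \<and> t < T - e \<longrightarrow> g t = 0" if e: "0 < e" for e
  proof -
    define b where "b t = flat 0 (t - e) * flat 0 (T - e - t)" for t
    have b: "0 \<le> b t" "b t \<le> 1" for t
      unfolding b_def using flat_nonneg flat_0_le by (auto intro: mult_le_one)
    have db: "\<exists>b'. (\<forall>t. (b has_real_derivative b' t) (at t)) \<and> continuous_on UNIV b'"
    proof -
      have d: "((\<lambda>t. flat m (t - e)) has_real_derivative (flat (m+2) (t - e) - real m * flat (m+1) (t - e)) * 1) (at t)"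
         "((\<lambda>t. flat m (T - e - t)) has_real_derivative (flat (m+2) (T - e - t) - real m * flat (m+1) (T - e - t)) * (-1)) (at t)"
          for m t
        by (rule DERIV_chain2[OF flat_has_real_derivative]; (rule derivative_eq_intros refl)+; simp)+
      have c: "continuous_on UNIV (\<lambda>t. flat m (t - e))" "continuous_on UNIV (\<lambda>t. flat m (T - e - t))" for m
        using d[THEN DERIV_isCont] by (auto intro!: continuous_at_imp_continuous_on)
      show ?thesis
        unfolding b_def
        by (rule exI, rule conjI, rule allI, rule DERIV_mult[OF d(1) d(2)], intro continuous_intros c)
    qed
    then obtain b' where b': "\<And>t. (b has_real_derivative b' t) (at t)" "continuous_on UNIV b'" by blast
    have b_cont: "continuous_on UNIV b"
      using b'(1)[THEN DERIV_isCont] by (auto intro!: continuous_at_imp_continuous_on)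
    have test: "(\<lambda>t. b t * poly (q n) t) \<in> time_tests T" for n
    proof -
      have "(\<lambda>t. b t * poly (q n) t) C1_differentiable_on UNIV"
        unfolding C1_differentiable_on_def has_real_derivative_iff_has_vector_derivative[symmetric]
        by (intro exI[of _ "\<lambda>t. b' t * poly (q n) t + poly (pderiv (q n)) t * b t"] conjI ballI)
           (auto intro!: DERIV_mult b' poly_DERIV continuous_intros b_cont)
      moreover have "{t. b t * poly (q n) t \<noteq> 0} \<subseteq> {e..T - e}"
        by (auto simp: b_def flat_def split: if_splits)
      then have "closure {t. b t * poly (q n) t \<noteq> 0} \<subseteq> {e..T - e}"
        by (rule closure_minimal) simp
      ultimately show ?thesis
        using e by (auto simp: time_tests_def compact_eq_bounded_closed intro: bounded_subset[OF bounded_closed_interval])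
    qed
    have bm: "b \<in> borel_measurable (lebesgue_on {0<..<T})" "\<And>n. poly (q n) \<in> borel_measurable (lebesgue_on {0<..<T})"
      by (intro continuous_imp_measurable_on_sets_lebesgue continuous_on_subset[OF b_cont] continuous_intros; simp)+
    note gm = borel_measurable_integrable[OF g]
    define n0 where "n0 = nat \<lceil>T\<rceil>"
    have "(\<lambda>n. LINT t|lebesgue_on {0<..<T}. g t * (b t * poly (q (n + n0)) t))
        \<longlonglongrightarrow> (LINT t|lebesgue_on {0<..<T}. g t * (b t * sgn (g t)))"
    proof (rule integral_dominated_convergence[where w="\<lambda>t. 2 * \<bar>g t\<bar>"])
      show "(\<lambda>t. g t * (b t * sgn (g t))) \<in> borel_measurable (lebesgue_on {0<..<T})"
        by (intro borel_measurable_times measurable_compose[OF gm sgn_measurable] gm bm)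
      show "(\<lambda>t. g t * (b t * poly (q (n + n0)) t)) \<in> borel_measurable (lebesgue_on {0<..<T})" for n
        by (intro borel_measurable_times gm bm)
      show "integrable (lebesgue_on {0<..<T}) (\<lambda>t. 2 * \<bar>g t\<bar>)" using g by simp
      have "AE t in lebesgue. t \<in> {0<..<T} \<longrightarrow> (\<lambda>n. g t * (b t * poly (q (n + n0)) t)) \<longlonglongrightarrow> g t * (b t * sgn (g t))"
        using q(2)
      proof eventually_elim
        case (elim t)
        then have "(\<lambda>n. poly (q n) t) \<longlonglongrightarrow> sg t" by simp
        from tendsto_mult_left[OF tendsto_mult_left[OF LIMSEQ_ignore_initial_segment[OF this]]]
        show ?case by (auto simp: sg_def)
      qed
      then show "AE t in lebesgue_on {0<..<T}. (\<lambda>n. g t * (b t * poly (q (n + n0)) t)) \<longlonglongrightarrow> g t * (b t * sgn (g t))"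
        by (simp add: AE_restrict_space_iff)
      show "AE t in lebesgue_on {0<..<T}. norm (g t * (b t * poly (q (n + n0)) t)) \<le> 2 * \<bar>g t\<bar>" for n
      proof (rule AE_I2)
        fix t assume "t \<in> space (lebesgue_on {0<..<T})"
        then have "\<bar>t\<bar> \<le> real (n + n0)" by (auto simp: n0_def) linarith
        then have "\<bar>poly (q (n + n0)) t\<bar> \<le> 2" using q(1)[of t "n + n0"] by simp
        then have "\<bar>b t\<bar> * \<bar>poly (q (n + n0)) t\<bar> \<le> 1 * 2" using b[of t] by (intro mult_mono) auto
        then have "\<bar>g t\<bar> * (\<bar>b t\<bar> * \<bar>poly (q (n + n0)) t\<bar>) \<le> \<bar>g t\<bar> * 2" by (intro mult_left_mono) auto
        then show "norm (g t * (b t * poly (q (n + n0)) t)) \<le> 2 * \<bar>g t\<bar>" by (simp add: abs_mult)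
      qed
    qed
    then have "(LINT t|lebesgue_on {0<..<T}. g t * (b t * sgn (g t))) = 0"
      using orth[OF test] by (simp add: LIMSEQ_const_iff)
    moreover have eq: "g t * (b t * sgn (g t)) = \<bar>g t\<bar> * b t" for t
      by (simp add: sgn_real_def)
    moreover have "integrable (lebesgue_on {0<..<T}) (\<lambda>t. \<bar>g t\<bar> * b t)"
      by (rule integrable_times_bounded[where B=1]) (use g bm b in auto)
    ultimately have "AE t in lebesgue_on {0<..<T}. \<bar>g t\<bar> * b t = 0"
      using b by (subst integral_nonneg_eq_0_iff_AE[symmetric]) auto
    then show ?thesis
      by eventually_elim (auto simp: b_def flat_def split: if_splits)
  qed
  then have "AE t in lebesgue_on {0<..<T}. \<forall>n. 1 / real (Suc n) < t \<and> t < T - 1 / real (Suc n) \<longrightarrow> g t = 0"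
    by (subst AE_all_countable) simp
  moreover have "AE t in lebesgue_on {0<..<T}. t \<in> {0<..<T}"
    by (rule AE_I2) simp
  ultimately show ?thesis
  proof eventually_elim
    case (elim t)
    then have "0 < min t (T - t)" by simp
    then obtain n where "1 / real (Suc n) < min t (T - t)" using nat_approx_posE by metis
    then have "1 / real (Suc n) < t \<and> t < T - 1 / real (Suc n)" by auto
    then show ?case using elim(1) by blast
  qed
qed

section \<open>The pressure equation at almost every time\<close>

lemma cutoff_bounded:
  assumes "0 < c"
  obtains B where "0 \<le> B" "\<And>s. 0 \<le> s \<Longrightarrow> \<bar>cutoff K c s\<bar> \<le> B" "\<And>s. 0 \<le> s \<Longrightarrow> s * \<bar>cutoff1 K c s\<bar> \<le> B"
proof -
  have c: "continuous_on {0..1/c} (\<lambda>s. \<bar>cutoff K c s\<bar> + s * \<bar>cutoff1 K c s\<bar>)"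
    using cutoff_derivative[THEN DERIV_isCont] cutoff1_derivative[THEN DERIV_isCont]
    by (intro continuous_intros continuous_at_imp_continuous_on ballI) auto
  have "bounded ((\<lambda>s. \<bar>cutoff K c s\<bar> + s * \<bar>cutoff1 K c s\<bar>) ` {0..1/c})"
    by (rule compact_imp_bounded[OF compact_continuous_image[OF c]]) simp
  then obtain B where "\<forall>y\<in>(\<lambda>s. \<bar>cutoff K c s\<bar> + s * \<bar>cutoff1 K c s\<bar>) ` {0..1/c}. norm y \<le> B"
    unfolding bounded_iff by blast
  then have B: "\<bar>\<bar>cutoff K c s\<bar> + s * \<bar>cutoff1 K c s\<bar>\<bar> \<le> B" if "s \<in> {0..1/c}" for s
    using that by auto
  have *: "\<bar>cutoff K c s\<bar> \<le> \<bar>B\<bar> \<and> s * \<bar>cutoff1 K c s\<bar> \<le> \<bar>B\<bar>" if "0 \<le> s" for s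
  proof (cases "s \<le> 1 / c")
    case True
    moreover have "0 \<le> s * \<bar>cutoff1 K c s\<bar>" using that by simp
    moreover have "\<bar>cutoff K c s\<bar> + s * \<bar>cutoff1 K c s\<bar> \<le> B" using B[of s] that True by auto
    ultimately show ?thesis by linarith
  next
    case False
    then have "1 \<le> c * s" using assms by (simp add: field_simps)
    then show ?thesis by (simp add: cutoff_eq_0)
  qed
  show thesis by (rule that[of "\<bar>B\<bar>"]) (use * in auto)
qed

lemma square_inner_le:
  fixes u x :: "'a::real_inner"
  shows "(u \<bullet> x)\<^sup>2 \<le> (norm u)\<^sup>2 * (x \<bullet> x)"
  using Cauchy_Schwarz_ineq[of u x] by (simp add: dot_square_norm)

text \<open>The Hessian of a radial potential paired with \<open>u \<otimes> u\<close>.\<close>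

lemma ddot_tensor_radial:
  fixes u x :: "real^'n::finite"
  assumes "\<And>i j. A $ i $ j = 4 * (x $ i * x $ j) * b + (if i = j then 2 * a else 0)"
  shows "ddot (tensor u u) A = 4 * (u \<bullet> x)\<^sup>2 * b + 2 * (norm u)\<^sup>2 * a"
proof -
  have "ddot (tensor u u) A = (\<Sum>i\<in>UNIV. \<Sum>j\<in>UNIV. 4 * b * ((u $ i * x $ i) * (u $ j * x $ j)))
     + (\<Sum>i\<in>UNIV. \<Sum>j\<in>UNIV. (if i = j then 2 * a * (u $ i * u $ j) else 0))"
    unfolding ddot_def tensor_def sum.distrib[symmetric]
    by (intro sum.cong refl) (auto simp: assms algebra_simps)
  also have "(\<Sum>i\<in>UNIV. \<Sum>j\<in>UNIV. 4 * b * ((u $ i * x $ i) * (u $ j * x $ j))) = 4 * (u \<bullet> x)\<^sup>2 * b"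
  proof -
    have "(u \<bullet> x)\<^sup>2 = (\<Sum>i\<in>UNIV. \<Sum>j\<in>UNIV. (u $ i * x $ i) * (u $ j * x $ j))"
      by (simp add: inner_vec_def power2_eq_square sum_product)
    then show ?thesis by (simp add: sum_distrib_left algebra_simps)
  qed
  also have "(\<Sum>i\<in>UNIV. \<Sum>j\<in>UNIV. (if i = j then 2 * a * (u $ i * u $ j) else 0)) = 2 * (norm u)\<^sup>2 * a"
    by (simp add: dot_square_norm[symmetric] inner_vec_def sum_distrib_left sum_distrib_right algebra_simps)
  finally show ?thesis .
qed

lemma Lq_2_iff: "u \<in> Lq 2 M \<longleftrightarrow> u \<in> borel_measurable M \<and> integrable M (\<lambda>x. (norm (u x))\<^sup>2)"
  by (auto simp: Lq_def powr_numeral)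

lemma Lq_1_iff: "u \<in> Lq 1 M \<longleftrightarrow> u \<in> borel_measurable M \<and> integrable M u"
  by (auto simp: Lq_def integrable_norm_iff)

lemma Lq_norm_2_square: "(Lq_norm 2 M u)\<^sup>2 = (LINT x|M. (norm (u x))\<^sup>2)"
proof -
  have "0 \<le> (LINT x|M. (norm (u x))\<^sup>2)" by simp
  then show ?thesis
    by (simp add: Lq_norm_def powr_numeral powr_half_sqrt)
qed

lemma Lq_norm_1: "Lq_norm 1 M u = (LINT x|M. norm (u x))"
  by (simp add: Lq_norm_def)

lemma time_test_props:
  assumes "\<xi> \<in> time_tests T"
  shows "continuous_on UNIV \<xi>" "\<exists>B. \<forall>t. \<bar>\<xi> t\<bar> \<le> B"
proof -
  show c: "continuous_on UNIV \<xi>"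
    using assms C1_differentiable_imp_continuous_on by (auto simp: time_tests_def)
  have "bounded (\<xi> ` closure {t. \<xi> t \<noteq> 0})"
    using assms by (intro compact_imp_bounded compact_continuous_image continuous_on_subset[OF c])
      (auto simp: time_tests_def)
  then obtain B where B: "\<And>t. t \<in> closure {t. \<xi> t \<noteq> 0} \<Longrightarrow> \<bar>\<xi> t\<bar> \<le> B"
    by (auto simp: bounded_iff)
  have "\<bar>\<xi> t\<bar> \<le> \<bar>B\<bar>" for t
    using B[of t] closure_subset[of "{t. \<xi> t \<noteq> 0}"] by (cases "\<xi> t = 0") auto
  then show "\<exists>B. \<forall>t. \<bar>\<xi> t\<bar> \<le> B" by blast
qed

lemma strip_borel_measurable:
  fixes g :: "'a::euclidean_space \<times> real \<Rightarrow> 'b::euclidean_space"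
  assumes "continuous_on UNIV g"
  shows "g \<in> borel_measurable (lebesgue_on (UNIV \<times> {0<..<T}))"
  using continuous_on_subset[OF assms] strip_measurable by (intro continuous_imp_measurable_on_sets_lebesgue) auto

lemma abs_integral_le:
  fixes f g :: "'a \<Rightarrow> real"
  assumes g: "integrable M g" and le: "\<And>x. \<bar>f x\<bar> \<le> g x"
  shows "\<bar>LINT x|M. f x\<bar> \<le> (LINT x|M. g x)"
proof -
  have "\<bar>LINT x|M. f x\<bar> \<le> (LINT x|M. \<bar>f x\<bar>)"
    using integral_norm_bound[of M f] by simp
  also have "\<dots> \<le> (LINT x|M. g x)"
    using le order_trans[OF abs_ge_zero le] by (intro integral_mono_AE'[OF g]) auto
  finally show ?thesis .
qed

lemma finite_measure_lebesgue_on_interval: "finite_measure (lebesgue_on {0<..<T::real})"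
  by (rule finite_measureI, cases "0 \<le> T") (auto simp: emeasure_restrict_space)

text \<open>The coefficient \<open>b\<close> is paired with \<open>(v \<bullet>
  x)\<^sup>2\<close>, so only \<open>|x|\<^sup>2 b\<close> has to be bounded.\<close>

lemma velocity_term_integrable:
  fixes v :: "real^'n::finite \<Rightarrow> real \<Rightarrow> real^'n" and a b :: "real^'n \<Rightarrow> real"
  assumes v: "v \<in> time_Lq \<infinity> T {Lq_norm 2 lebesgue} (Lq_sigma 2)"
    and a: "continuous_on UNIV a" "\<And>x. \<bar>a x\<bar> \<le> B"
    and b: "continuous_on UNIV b" "\<And>x. (x \<bullet> x) * \<bar>b x\<bar> \<le> B"
  shows "integrable (lebesgue_on {0<..<T})
    (\<lambda>t. LINT x|lebesgue. (v x t \<bullet> x)\<^sup>2 * b x + (norm (v x t))\<^sup>2 * a x)"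
proof -
  let ?G = "\<lambda>z. (v (fst z) (snd z) \<bullet> fst z)\<^sup>2 * b (fst z) + (norm (v (fst z) (snd z)))\<^sup>2 * a (fst z)"
  have vm: "(\<lambda>z. v (fst z) (snd z)) \<in> borel_measurable (lebesgue_on (UNIV \<times> {0<..<T}))"
    and slice: "AE t in lebesgue_on {0<..<T}. (\<lambda>x. v x t) \<in> Lq_sigma 2"
    and norm: "(\<lambda>t. Lq_norm 2 lebesgue (\<lambda>x. v x t)) \<in> Lq \<infinity> (lebesgue_on {0<..<T})"
    using v by (auto simp: time_Lq_def)
  obtain M where M: "AE t in lebesgue_on {0<..<T}. norm (Lq_norm 2 lebesgue (\<lambda>x. v x t)) \<le> M"
    using norm by (auto simp: Lq_def)
  have "?G \<in> borel_measurable (lebesgue_on (UNIV \<times> {0<..<T}))"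
    by (intro borel_measurable_add borel_measurable_times borel_measurable_power borel_measurable_inner
        borel_measurable_norm vm measurable_compose[OF vm borel_measurable_norm] strip_borel_measurable continuous_on_compose2[OF a(1)] continuous_on_compose2[OF b(1)]
        continuous_intros) auto
  from slice_integral_measurable[OF this]
  have m: "(\<lambda>t. LINT x|lebesgue. (v x t \<bullet> x)\<^sup>2 * b x + (norm (v x t))\<^sup>2 * a x)
     \<in> borel_measurable (lebesgue_on {0<..<T})" by simp
  have "AE t in lebesgue_on {0<..<T}.
      norm (LINT x|lebesgue. (v x t \<bullet> x)\<^sup>2 * b x + (norm (v x t))\<^sup>2 * a x) \<le> 2 * B * M\<^sup>2"
    using slice M
  proof eventually_elim
    case (elim t)
    have i: "integrable lebesgue (\<lambda>x. 2 * B * (norm (v x t))\<^sup>2)"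
      using elim(1) by (auto simp: Lq_sigma_def Lq_2_iff)
    have "\<bar>LINT x|lebesgue. (v x t \<bullet> x)\<^sup>2 * b x + (norm (v x t))\<^sup>2 * a x\<bar>
       \<le> (LINT x|lebesgue. 2 * B * (norm (v x t))\<^sup>2)"
    proof (rule abs_integral_le[OF i])
      fix x
      have "\<bar>(v x t \<bullet> x)\<^sup>2 * b x\<bar> \<le> (norm (v x t))\<^sup>2 * ((x \<bullet> x) * \<bar>b x\<bar>)"
        using mult_right_mono[OF square_inner_le[of "v x t" x] abs_ge_zero[of "b x"]]
        by (simp add: abs_mult mult.assoc)
      also have "\<dots> \<le> (norm (v x t))\<^sup>2 * B" by (intro mult_left_mono b) simp
      finally have "\<bar>(v x t \<bullet> x)\<^sup>2 * b x\<bar> \<le> (norm (v x t))\<^sup>2 * B" .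
      moreover have "\<bar>(norm (v x t))\<^sup>2 * a x\<bar> \<le> (norm (v x t))\<^sup>2 * B"
        unfolding abs_mult abs_power2 by (intro mult_left_mono a) simp
      ultimately show "\<bar>(v x t \<bullet> x)\<^sup>2 * b x + (norm (v x t))\<^sup>2 * a x\<bar> \<le> 2 * B * (norm (v x t))\<^sup>2"
        by (simp add: algebra_simps)
    qed
    also have "\<dots> = 2 * B * (Lq_norm 2 lebesgue (\<lambda>x. v x t))\<^sup>2"
      by (simp add: Lq_norm_2_square)
    also have "\<dots> \<le> 2 * B * M\<^sup>2"
    proof (rule mult_left_mono)
      have "\<bar>Lq_norm 2 lebesgue (\<lambda>x. v x t)\<bar> \<le> \<bar>M\<bar>" using elim(2) by simp
      then show "(Lq_norm 2 lebesgue (\<lambda>x. v x t))\<^sup>2 \<le> M\<^sup>2" by (rule abs_le_square_iff[THEN iffD1])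
      show "0 \<le> 2 * B" using a(2)[of 0] by simp
    qed
    finally show ?case by simp
  qed
  then show ?thesis
    using m by (rule finite_measure.integrable_const_bound[OF finite_measure_lebesgue_on_interval])
qed

lemma pressure_term_integrable:
  fixes p :: "real^'n::finite \<Rightarrow> real \<Rightarrow> real" and d :: "real^'n \<Rightarrow> real"
  assumes p: "p \<in> time_Lq 1 T (local_norms 1) (Lq_loc 1)"
    and d: "continuous_on UNIV d" "\<And>x. \<bar>d x\<bar> \<le> B" "\<And>x. R \<le> norm x \<Longrightarrow> d x = 0"
  shows "integrable (lebesgue_on {0<..<T}) (\<lambda>t. LINT x|lebesgue. p x t * d x)"
proof -
  let ?K = "cball 0 R :: (real^'n) set"
  have pm: "(\<lambda>z. p (fst z) (snd z)) \<in> borel_measurable (lebesgue_on (UNIV \<times> {0<..<T}))"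
    and slice: "AE t in lebesgue_on {0<..<T}. (\<lambda>x. p x t) \<in> Lq_loc 1"
    and norms: "\<forall>s\<in>local_norms 1. (\<lambda>t. s (\<lambda>x. p x t)) \<in> Lq 1 (lebesgue_on {0<..<T})"
    using p by (auto simp: time_Lq_def)
  have "Lq_norm 1 (lebesgue_on ?K) \<in> local_norms 1"
    unfolding local_norms_def using compact_cball by blast
  with norms have norm: "(\<lambda>t. Lq_norm 1 (lebesgue_on ?K) (\<lambda>x. p x t)) \<in> Lq 1 (lebesgue_on {0<..<T})"
    by (rule bspec)
  have "(\<lambda>z. p (fst z) (snd z) * d (fst z)) \<in> borel_measurable (lebesgue_on (UNIV \<times> {0<..<T}))"
    by (intro borel_measurable_times pm strip_borel_measurable continuous_on_compose2[OF d(1)]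
        continuous_intros) auto
  from slice_integral_measurable[OF this]
  have m: "(\<lambda>t. LINT x|lebesgue. p x t * d x) \<in> borel_measurable (lebesgue_on {0<..<T})" by simp
  show ?thesis
  proof (rule Bochner_Integration.integrable_bound[OF _ m])
    show "integrable (lebesgue_on {0<..<T}) (\<lambda>t. B * Lq_norm 1 (lebesgue_on ?K) (\<lambda>x. p x t))"
      using norm by (simp add: Lq_1_iff)
    show "AE t in lebesgue_on {0<..<T}. norm (LINT x|lebesgue. p x t * d x)
        \<le> norm (B * Lq_norm 1 (lebesgue_on ?K) (\<lambda>x. p x t))"
      using slice
    proof eventually_elim
      case (elim t)
      have i: "integrable (lebesgue_on ?K) (\<lambda>x. p x t)"
        using elim by (auto simp: Lq_loc_def Lq_1_iff)
      then have "integrable lebesgue (\<lambda>x. indicator ?K x *\<^sub>R p x t)"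
        by (subst (asm) integrable_restrict_space) auto
      then have i': "integrable lebesgue (\<lambda>x. B * norm (indicator ?K x *\<^sub>R p x t))"
        by simp
      have "\<bar>LINT x|lebesgue. p x t * d x\<bar> \<le> (LINT x|lebesgue. B * norm (indicator ?K x *\<^sub>R p x t))"
      proof (rule abs_integral_le[OF i'])
        fix x
        show "\<bar>p x t * d x\<bar> \<le> B * norm (indicator ?K x *\<^sub>R p x t)"
        proof (cases "x \<in> ?K")
          case True
          then show ?thesis using mult_right_mono[OF d(2)[of x] abs_ge_zero[of "p x t"]]
            by (simp add: abs_mult mult.commute)
        next
          case False
          then show ?thesis using d(3)[of x] by simp
        qed
      qed
      also have "\<dots> = B * (LINT x|lebesgue. indicator ?K x *\<^sub>R norm (p x t))"
        by (simp add: abs_mult)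
      also have "(LINT x|lebesgue. indicator ?K x *\<^sub>R norm (p x t)) = Lq_norm 1 (lebesgue_on ?K) (\<lambda>x. p x t)"
        unfolding Lq_norm_1 by (rule integral_restrict_space[symmetric]) simp
      finally show ?case by simp
    qed
  qed
qed

lemma set_integral_lebesgue_on:
  fixes f :: "real \<Rightarrow> real"
  shows "(LINT t:{0<..<T}|lebesgue. f t) = (LINT t|lebesgue_on {0<..<T}. f t)"
  unfolding set_lebesgue_integral_def by (rule integral_restrict_space[symmetric]) simp

text \<open>Applied to the time derivative and the force with \<open>\<psi>\<close> itself, and to
  the viscous term with \<open>\<Delta>\<psi>\<close>.\<close>

lemma div_free_term_vanishes:
  fixes u :: "real^'n::finite \<Rightarrow> real \<Rightarrow> real^'n"
  assumes "AE t in lebesgue_on {0<..<T}. div_free (\<lambda>x. u x t)" "\<psi> \<in> test_functions"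
  shows "(LINT t:{0<..<T}|lebesgue. LINT x|lebesgue. (u x t \<bullet> grad \<psi> x) * \<xi> t) = 0"
  unfolding set_integral_lebesgue_on
  by (rule integral_eq_zero_AE) (use assms(1) in eventually_elim, use assms(2) in \<open>simp add: div_free_def\<close>)

text \<open>The equation \<open>- \<Delta>p = div div (v \<otimes> v)\<close>, tested with one
  radial potential at almost every time. Testing the system with \<open>\<xi>
  \<nabla>\<psi>\<close> leaves only the convective and the pressure term, and
  \<open>\<xi>\<close> is then removed. The exceptional set of times depends on \<open>K\<close>
  and \<open>c\<close>, so only countably many of them may be used later.\<close>

lemma pressure_equation_slice:
  fixes v f :: "real^'n::finite \<Rightarrow> real \<Rightarrow> real^'n"
  assumes sol: "NS_weak_solution \<nu> T f v p"
    and v: "v \<in> time_Lq \<infinity> T {Lq_norm 2 lebesgue} (Lq_sigma 2)"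
    and c: "0 < c"
  shows "AE t in lebesgue_on {0<..<T}.
     (LINT x|lebesgue. (v x t \<bullet> x)\<^sup>2 * (4 * cutoff1 K c (x \<bullet> x)) + (norm (v x t))\<^sup>2 * (2 * cutoff K c (x \<bullet> x)))
   + (LINT x|lebesgue. p x t * (4 * (x \<bullet> x) * cutoff1 K c (x \<bullet> x) + 2 * real CARD('n) * cutoff K c (x \<bullet> x))) = 0"
    (is "AE t in _. ?E t + ?P t = 0")
proof -
  obtain \<psi> \<Delta> :: "real^'n \<Rightarrow> real" where \<psi>: "\<psi> \<in> test_functions" "\<Delta> \<in> test_functions" "grad \<psi> \<in> test_fields"
    and hess: "\<And>x i j. grad_field (grad \<psi>) x $ i $ j =
       4 * (x $ i * x $ j) * cutoff1 K c (x \<bullet> x) + (if i = j then 2 * cutoff K c (x \<bullet> x) else 0)"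
    and div: "\<And>x. divergence (grad \<psi>) x = \<Delta> x"
    and lap: "laplacian_field (grad \<psi>) = grad \<Delta>"
    and \<Delta>: "\<And>x. \<Delta> x = 4 * (x \<bullet> x) * cutoff1 K c (x \<bullet> x) + 2 * real CARD('n) * cutoff K c (x \<bullet> x)"
    using radial_test_function[OF c, of K] by blast
  obtain B where B: "0 \<le> B" "\<And>s. 0 \<le> s \<Longrightarrow> \<bar>cutoff K c s\<bar> \<le> B" "\<And>s. 0 \<le> s \<Longrightarrow> s * \<bar>cutoff1 K c s\<bar> \<le> B"
    using cutoff_bounded[OF c] by blast
  have cont: "continuous_on UNIV (\<lambda>x::real^'n. cutoff K c (x \<bullet> x))"
     "continuous_on UNIV (\<lambda>x::real^'n. cutoff1 K c (x \<bullet> x))"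
    using smooth_algebra_Ck[OF smooth_algebra_cutoff(1), of 0] smooth_algebra_Ck[OF smooth_algebra_cutoff(2), of 0] by auto
  have vdf: "AE t in lebesgue_on {0<..<T}. div_free (\<lambda>x. v x t)"
    using sol by (auto simp: NS_weak_solution_def time_Lq_def Lq_loc_sigma_def)
  have fdf: "AE t in lebesgue_on {0<..<T}. div_free (\<lambda>x. f x t)"
    using sol by (auto simp: NS_weak_solution_def time_Lq_def Lq_loc_sigma_def)
  have E: "integrable (lebesgue_on {0<..<T}) ?E"
  proof (rule velocity_term_integrable[OF v, where B="4 * B"])
    show "\<bar>2 * cutoff K c (x \<bullet> x)\<bar> \<le> 4 * B" for x :: "real^'n"
      using B(1) B(2)[of "x \<bullet> x"] by simp
    show "(x \<bullet> x) * \<bar>4 * cutoff1 K c (x \<bullet> x)\<bar> \<le> 4 * B" for x :: "real^'n"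
      using B(3)[of "x \<bullet> x"] by (simp add: abs_mult)
  qed (intro continuous_intros cont)+
  have P: "integrable (lebesgue_on {0<..<T}) ?P"
  proof (rule pressure_term_integrable[where B="(4 + 2 * real CARD('n)) * B" and R="1 / sqrt c"])
    show "p \<in> time_Lq 1 T (local_norms 1) (Lq_loc 1)"
      using sol by (simp add: NS_weak_solution_def)
    show "continuous_on UNIV (\<lambda>x::real^'n. 4 * (x \<bullet> x) * cutoff1 K c (x \<bullet> x) + 2 * real CARD('n) * cutoff K c (x \<bullet> x))"
      by (intro continuous_intros cont)
    show "\<bar>4 * (x \<bullet> x) * cutoff1 K c (x \<bullet> x) + 2 * real CARD('n) * cutoff K c (x \<bullet> x)\<bar>
        \<le> (4 + 2 * real CARD('n)) * B" for x :: "real^'n"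
    proof -
      have "\<bar>4 * (x \<bullet> x) * cutoff1 K c (x \<bullet> x)\<bar> \<le> 4 * B"
        using B(3)[of "x \<bullet> x"] by (simp add: abs_mult)
      moreover have "\<bar>2 * real CARD('n) * cutoff K c (x \<bullet> x)\<bar> \<le> 2 * real CARD('n) * B"
        using B(2)[of "x \<bullet> x"] by (simp add: abs_mult)
      ultimately show ?thesis by (simp add: algebra_simps)
    qed
    show "4 * (x \<bullet> x) * cutoff1 K c (x \<bullet> x) + 2 * real CARD('n) * cutoff K c (x \<bullet> x) = 0"
      if "1 / sqrt c \<le> norm x" for x :: "real^'n"
      using one_le_outside_ball[OF c that] by (simp add: cutoff_eq_0)
  qed
  show ?thesis
  proof (rule orthogonal_to_time_tests_imp_AE_0)
    show "integrable (lebesgue_on {0<..<T}) (\<lambda>t. ?E t + ?P t)" using E P by simp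
    fix \<xi> assume \<xi>: "\<xi> \<in> time_tests T"
    obtain M where M: "\<And>t. \<bar>\<xi> t\<bar> \<le> M" using time_test_props(2)[OF \<xi>] by blast
    have \<xi>m: "\<xi> \<in> borel_measurable (lebesgue_on {0<..<T})"
      using time_test_props(1)[OF \<xi>]
      by (intro continuous_imp_measurable_on_sets_lebesgue) (auto intro: continuous_on_subset)
    have i: "integrable (lebesgue_on {0<..<T}) (\<lambda>t. ?E t * \<xi> t)" "integrable (lebesgue_on {0<..<T}) (\<lambda>t. ?P t * \<xi> t)"
      using E P \<xi>m M by (auto intro!: integrable_times_bounded[where B=M])
    have eq1: "(LINT x|lebesgue. ddot (tensor (v x t) (v x t)) (grad_field (grad \<psi>) x) * \<xi> t) = ?E t * \<xi> t" for t
    proof -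
      have "ddot (tensor (v x t) (v x t)) (grad_field (grad \<psi>) x)
          = (v x t \<bullet> x)\<^sup>2 * (4 * cutoff1 K c (x \<bullet> x)) + (norm (v x t))\<^sup>2 * (2 * cutoff K c (x \<bullet> x))" for x
        by (simp add: ddot_tensor_radial[OF hess])
      then show ?thesis by (simp only: integral_mult_left_zero)
    qed
    have eq2: "(LINT x|lebesgue. p x t * divergence (grad \<psi>) x * \<xi> t) = ?P t * \<xi> t" for t
      by (simp only: div \<Delta> integral_mult_left_zero)
    have "- (LINT t:{0<..<T}|lebesgue. LINT x|lebesgue. (v x t \<bullet> grad \<psi> x) * deriv \<xi> t)
        - (LINT t:{0<..<T}|lebesgue. LINT x|lebesgue.
             ddot (tensor (v x t) (v x t)) (grad_field (grad \<psi>) x) * \<xi> t)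
        = (LINT t:{0<..<T}|lebesgue. LINT x|lebesgue. p x t * divergence (grad \<psi>) x * \<xi> t)
        + \<nu> * (LINT t:{0<..<T}|lebesgue. LINT x|lebesgue. (v x t \<bullet> laplacian_field (grad \<psi>) x) * \<xi> t)
        + (LINT t:{0<..<T}|lebesgue. LINT x|lebesgue. (f x t \<bullet> grad \<psi> x) * \<xi> t)"
      using sol \<psi>(3) \<xi> unfolding NS_weak_solution_def by blast
    then have "(LINT t|lebesgue_on {0<..<T}. ?E t * \<xi> t) + (LINT t|lebesgue_on {0<..<T}. ?P t * \<xi> t) = 0"
      unfolding lap div_free_term_vanishes[OF vdf \<psi>(1)] div_free_term_vanishes[OF vdf \<psi>(2)]
        div_free_term_vanishes[OF fdf \<psi>(1)]
      unfolding eq1 eq2 set_integral_lebesgue_on by simp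
    then show "(LINT t|lebesgue_on {0<..<T}. (?E t + ?P t) * \<xi> t) = 0"
      unfolding distrib_right by (subst Bochner_Integration.integral_add[OF i])
  qed
qed

section \<open>Removing the approximation and the cutoff\<close>

text \<open>With \<open>a\<close> for \<open>w(r)\<close> and \<open>b\<close> for
  \<open>W(r)/r\<close>, where \<open>W\<close> is the primitive of \<open>w\<close>, these are
  the integrands of the pressure equation for the potential cut off at \<open>|x|\<^sup>2 = 1 /
  c\<close>: the Hessian applied to \<open>u\<close>, and the Laplacian. At \<open>c = 0\<close>
  the second one is the pressure weight, up to the factor \<open>exp (- 1)\<close>. Polynomial
  approximations and their limits are both instances.\<close>

definition velocity_density :: "real \<Rightarrow> real \<Rightarrow> real \<Rightarrow> 'a::real_inner \<Rightarrow> 'a \<Rightarrow> real" where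
  "velocity_density c a b u x =
     (u \<bullet> x)\<^sup>2 / (x \<bullet> x) * ((a - b) * flat 0 (1 - c * (x \<bullet> x)) - 2 * b * (c * (x \<bullet> x) * flat 2 (1 - c * (x \<bullet> x))))
     + (norm u)\<^sup>2 * (b * flat 0 (1 - c * (x \<bullet> x)))"

definition weight_density :: "real \<Rightarrow> real \<Rightarrow> real \<Rightarrow> real \<Rightarrow> 'a::real_inner \<Rightarrow> real" where
  "weight_density N c a b x =
     (a + (N - 1) * b) * flat 0 (1 - c * (x \<bullet> x)) - 2 * b * (c * (x \<bullet> x) * flat 2 (1 - c * (x \<bullet> x)))"

text \<open>The cutoff depends on \<open>c |x|\<^sup>2\<close> only, so \<open>s\<close> times its
  derivative in \<open>s\<close> is bounded independently of the radius.\<close>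

lemma cutoff_factor_bound:
  assumes "0 \<le> c" "0 \<le> s"
  shows "0 \<le> c * s * flat 2 (1 - c * s)" "c * s * flat 2 (1 - c * s) \<le> 2"
proof -
  show "0 \<le> c * s * flat 2 (1 - c * s)" using assms flat_nonneg by simp
  show "c * s * flat 2 (1 - c * s) \<le> 2"
  proof (cases "c * s \<le> 1")
    case True
    then have "c * s * flat 2 (1 - c * s) \<le> 1 * 2"
      using assms flat_2_le flat_nonneg by (intro mult_mono) auto
    then show ?thesis by simp
  qed (simp add: flat_def)
qed

lemma density_eq_0:
  assumes "1 \<le> c * (x \<bullet> x)"
  shows "velocity_density c a b u x = 0" "weight_density N c a b x = 0"
  using assms by (auto simp: velocity_density_def weight_density_def flat_def)

lemma abs_mult_le:
  fixes x y :: real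
  assumes "\<bar>x\<bar> \<le> a" "\<bar>y\<bar> \<le> b"
  shows "\<bar>x * y\<bar> \<le> a * b"
  unfolding abs_mult using assms by (intro mult_mono) auto

lemma velocity_density_bound:
  fixes u x :: "'a::real_inner"
  assumes c: "0 \<le> c" and a: "\<bar>a\<bar> \<le> B" and b: "\<bar>b\<bar> \<le> B"
  shows "\<bar>velocity_density c a b u x\<bar> \<le> 7 * B * (norm u)\<^sup>2"
proof -
  let ?p = "flat 0 (1 - c * (x \<bullet> x))" and ?r = "c * (x \<bullet> x) * flat 2 (1 - c * (x \<bullet> x))"
  have p: "\<bar>?p\<bar> \<le> 1" using flat_nonneg flat_0_le by simp
  have r: "\<bar>?r\<bar> \<le> 2" using cutoff_factor_bound[OF c, of "x \<bullet> x"] by simp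
  have 1: "\<bar>(a - b) * ?p - 2 * b * ?r\<bar> \<le> 6 * B"
    using abs_mult_le[of "a - b" "2 * B" ?p 1] abs_mult_le[of "2 * b" "2 * B" ?r 2] a b p r by linarith
  have 2: "\<bar>(u \<bullet> x)\<^sup>2 / (x \<bullet> x)\<bar> \<le> (norm u)\<^sup>2"
    using square_inner_le[of u x] by (cases "x = 0") (auto simp: divide_le_eq)
  have 3: "\<bar>(norm u)\<^sup>2 * (b * ?p)\<bar> \<le> (norm u)\<^sup>2 * (B * 1)"
    by (intro abs_mult_le b p) simp
  show ?thesis
    unfolding velocity_density_def
    by (rule order_trans[OF order_trans[OF abs_triangle_ineq add_mono[OF abs_mult_le[OF 2 1] 3]]])
      (simp add: algebra_simps)
qed

lemma weight_density_bound:
  assumes c: "0 \<le> c" and N: "1 \<le> N" and a: "\<bar>a\<bar> \<le> B" and b: "\<bar>b\<bar> \<le> B"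
  shows "\<bar>weight_density N c a b x\<bar> \<le> (N + 4) * B"
proof -
  let ?p = "flat 0 (1 - c * (x \<bullet> x))" and ?r = "c * (x \<bullet> x) * flat 2 (1 - c * (x \<bullet> x))"
  have p: "\<bar>?p\<bar> \<le> 1" using flat_nonneg flat_0_le by simp
  have r: "\<bar>?r\<bar> \<le> 2" using cutoff_factor_bound[OF c, of "x \<bullet> x"] by simp
  have "\<bar>(N - 1) * b\<bar> \<le> (N - 1) * B" using N b by (intro abs_mult_le) auto
  then have "\<bar>a + (N - 1) * b\<bar> \<le> N * B" using a by (simp add: algebra_simps)
  then have 1: "\<bar>(a + (N - 1) * b) * ?p\<bar> \<le> (N * B) * 1" using p by (rule abs_mult_le)
  have 2: "\<bar>2 * b * ?r\<bar> \<le> (2 * B) * 2" using b r by (intro abs_mult_le) auto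
  have 3: "(N + 4) * B = (N * B) * 1 + (2 * B) * 2" by (simp add: algebra_simps)
  show ?thesis unfolding weight_density_def 3
    by (rule order_trans[OF abs_triangle_ineq4 add_mono[OF 1 2]])
qed

text \<open>The error made by cutting off is at most \<open>4 b\<close>, and \<open>b \<le> (N -
  1) b\<close> in dimension at least two. Thus an integrable multiple of pressure times weight
  dominates the pressure integrand for all cutoffs at once.\<close>

lemma weight_density_le_weight:
  assumes c: "0 \<le> c" and N: "2 \<le> N" and a: "0 \<le> a" and b: "0 \<le> b"
  shows "\<bar>weight_density N c a b x\<bar> \<le> 5 * (a + (N - 1) * b)"
proof -
  let ?p = "flat 0 (1 - c * (x \<bullet> x))" and ?r = "c * (x \<bullet> x) * flat 2 (1 - c * (x \<bullet> x))"
  have p: "\<bar>?p\<bar> \<le> 1" using flat_nonneg flat_0_le by simp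
  have r: "\<bar>?r\<bar> \<le> 2" using cutoff_factor_bound[OF c, of "x \<bullet> x"] by simp
  have b': "b \<le> (N - 1) * b" using mult_right_mono[of 1 "N - 1" b] N b by simp
  have "\<bar>a + (N - 1) * b\<bar> \<le> a + (N - 1) * b" using a b N by simp
  then have 1: "\<bar>(a + (N - 1) * b) * ?p\<bar> \<le> (a + (N - 1) * b) * 1" using p by (rule abs_mult_le)
  have 2: "\<bar>2 * b * ?r\<bar> \<le> (2 * b) * 2" using b r by (intro abs_mult_le) auto
  have "(a + (N - 1) * b) * 1 + (2 * b) * 2 \<le> 5 * (a + (N - 1) * b)"
  proof -
    define m where "m = (N - 1) * b"
    show ?thesis using a b' unfolding m_def[symmetric] by simp
  qed
  then show ?thesis unfolding weight_density_def
    by (rule order_trans[OF order_trans[OF abs_triangle_ineq4 add_mono[OF 1 2]]])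
qed

lemma density_tendsto:
  assumes "(a \<longlongrightarrow> a') F" "(b \<longlongrightarrow> b') F" "(c \<longlongrightarrow> c') F"
  shows "((\<lambda>n. velocity_density (c n) (a n) (b n) u x) \<longlongrightarrow> velocity_density c' a' b' u x) F"
    "((\<lambda>n. weight_density N (c n) (a n) (b n) x) \<longlongrightarrow> weight_density N c' a' b' x) F"
  unfolding velocity_density_def weight_density_def divide_inverse
  by (intro tendsto_intros assms continuous_on_tendsto_compose[OF flat_continuous]; simp)+

lemma borel_measurable_AE_LIMSEQ:
  fixes f :: "nat \<Rightarrow> 'a::euclidean_space \<Rightarrow> real"
  assumes "\<And>n. f n \<in> borel_measurable lebesgue" "AE x in lebesgue. (\<lambda>n. f n x) \<longlonglongrightarrow> l x"
  shows "l \<in> borel_measurable lebesgue"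
proof (rule borel_measurable_AE)
  show "(\<lambda>x. lim (\<lambda>n. f n x)) \<in> borel_measurable lebesgue"
    using assms(1) by (rule borel_measurable_lim_metric)
  show "AE x in lebesgue. lim (\<lambda>n. f n x) = l x"
    using assms(2) by eventually_elim (rule limI)
qed

lemma lebesgue_measurable_continuous:
  "continuous_on UNIV (h :: 'a::euclidean_space \<Rightarrow> 'b::euclidean_space) \<Longrightarrow> h \<in> borel_measurable lebesgue"
  by (intro measurable_completion) (simp add: borel_measurable_continuous_onI)

lemma
  fixes a b :: "'a::euclidean_space \<Rightarrow> real"
  assumes a: "a \<in> borel_measurable lebesgue" and b: "b \<in> borel_measurable lebesgue"
  shows weight_density_measurable: "(\<lambda>x. weight_density N c (a x) (b x) x) \<in> borel_measurable lebesgue"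
    and velocity_density_measurable: "u \<in> borel_measurable lebesgue \<Longrightarrow>
      (\<lambda>x. velocity_density c (a x) (b x) (u x) x) \<in> borel_measurable lebesgue"
proof -
  have i: "(\<lambda>x::'a. x) \<in> borel_measurable lebesgue"
    by (intro lebesgue_measurable_continuous continuous_intros)
  have f: "(\<lambda>x::'a. flat m (1 - c * (x \<bullet> x))) \<in> borel_measurable lebesgue" for m
    by (intro lebesgue_measurable_continuous continuous_on_compose2[OF flat_continuous] continuous_intros) auto
  show "(\<lambda>x. weight_density N c (a x) (b x) x) \<in> borel_measurable lebesgue"
    unfolding weight_density_def by (intro borel_measurable_add borel_measurable_diff borel_measurable_times
      borel_measurable_inner a b i f borel_measurable_const)
  assume u: "u \<in> borel_measurable lebesgue"
  show "(\<lambda>x. velocity_density c (a x) (b x) (u x) x) \<in> borel_measurable lebesgue"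
    unfolding velocity_density_def by (intro borel_measurable_add borel_measurable_diff borel_measurable_times borel_measurable_divide
      borel_measurable_power borel_measurable_inner measurable_compose[OF u borel_measurable_norm] u a b i f borel_measurable_const)
qed

lemma Lq_loc_1_props:
  fixes P :: "real^'n::finite \<Rightarrow> real"
  assumes "P \<in> Lq_loc 1"
  shows "integrable lebesgue (\<lambda>x. indicator (cball 0 R) x *\<^sub>R P x)" "P \<in> borel_measurable lebesgue"
proof -
  show i: "integrable lebesgue (\<lambda>x. indicator (cball 0 R) x *\<^sub>R P x)" for R
  proof -
    have "integrable (lebesgue_on (cball 0 R)) P" using assms by (auto simp: Lq_loc_def Lq_1_iff)
    then show ?thesis by (subst (asm) integrable_restrict_space) auto
  qed
  have "(\<lambda>n. indicator (cball 0 (real n)) x *\<^sub>R P x) \<longlonglongrightarrow> P x" for x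
  proof (rule tendsto_eventually)
    have "eventually (\<lambda>n. norm x \<le> real n) sequentially"
      using filterlim_real_sequentially by (simp add: filterlim_at_top)
    then show "eventually (\<lambda>n. indicator (cball 0 (real n)) x *\<^sub>R P x = P x) sequentially"
      by eventually_elim simp
  qed
  then show "P \<in> borel_measurable lebesgue"
    by (intro borel_measurable_AE_LIMSEQ[OF borel_measurable_integrable[OF i]] AE_I2)
qed

text \<open>Two limits in the balance of stress and pressure. For fixed \<open>c\<close>
  everything lives in a ball, where the approximating profiles are bounded, the pressure is
  integrable and \<open>|u|\<^sup>2\<close> is integrable; this replaces \<open>A n\<close>,
  \<open>M n\<close> by \<open>\<alpha>\<close>, \<open>\<mu>\<close>. Then \<open>c\<close> tends
  to 0, dominated by \<open>|u|\<^sup>2\<close> and, through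
  \<open>weight_density_le_weight\<close>, by pressure times weight. In the limit the pressure
  integral is nonnegative, and the stress integrand is \<open>\<alpha> |u\<^sub>r|\<^sup>2 + \<mu>
  (|u|\<^sup>2 - |u\<^sub>r|\<^sup>2)\<close> with \<open>u\<^sub>r\<close> the radial component,
  which is nonnegative and positive unless \<open>u = 0\<close>.\<close>

lemma vanishing_from_balance:
  fixes u :: "real^'n::finite \<Rightarrow> real^'n" and P \<alpha> \<mu> :: "real^'n \<Rightarrow> real"
    and A M :: "nat \<Rightarrow> real^'n \<Rightarrow> real" and N :: real
  assumes N: "2 \<le> N" and u: "u \<in> Lq 2 lebesgue" and P: "P \<in> Lq_loc 1"
    and cont: "\<And>n. continuous_on UNIV (A n)" "\<And>n. continuous_on UNIV (M n)"
    and bound: "\<And>n x. x \<bullet> x \<le> real n \<Longrightarrow> \<bar>A n x\<bar> \<le> B" "\<And>n x. x \<bullet> x \<le> real n \<Longrightarrow> \<bar>M n x\<bar> \<le> B"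
    and lim: "AE x in lebesgue. (\<lambda>n. A n x) \<longlonglongrightarrow> \<alpha> x" "AE x in lebesgue. (\<lambda>n. M n x) \<longlonglongrightarrow> \<mu> x"
    and pos: "AE x in lebesgue. 0 < \<alpha> x" "AE x in lebesgue. 0 < \<mu> x"
    and weight: "integrable lebesgue (\<lambda>x. P x * (\<alpha> x + (N - 1) * \<mu> x))"
      "0 \<le> (LINT x|lebesgue. P x * (\<alpha> x + (N - 1) * \<mu> x))"
    and balance: "\<And>n k. (LINT x|lebesgue. velocity_density (1 / real (Suc k)) (A n x) (M n x) (u x) x)
      + (LINT x|lebesgue. P x * weight_density N (1 / real (Suc k)) (A n x) (M n x) x) = 0"
  shows "AE x in lebesgue. u x = 0"
proof -
  have um: "u \<in> borel_measurable lebesgue" and ui: "integrable lebesgue (\<lambda>x. (norm (u x))\<^sup>2)"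
    using u by (auto simp: Lq_2_iff)
  note Pm = Lq_loc_1_props(2)[OF P]
  have Am: "A n \<in> borel_measurable lebesgue" and Mm: "M n \<in> borel_measurable lebesgue" for n
    using cont by (auto intro: lebesgue_measurable_continuous)
  have \<alpha>m: "\<alpha> \<in> borel_measurable lebesgue" and \<mu>m: "\<mu> \<in> borel_measurable lebesgue"
    using borel_measurable_AE_LIMSEQ[OF Am lim(1)] borel_measurable_AE_LIMSEQ[OF Mm lim(2)] by auto
  have B: "AE x in lebesgue. \<bar>\<alpha> x\<bar> \<le> B \<and> \<bar>\<mu> x\<bar> \<le> B"
    using lim
  proof eventually_elim
    case (elim x)
    have "eventually (\<lambda>n. x \<bullet> x \<le> real n) sequentially"
      using filterlim_real_sequentially by (simp add: filterlim_at_top)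
    then have "eventually (\<lambda>n. \<bar>A n x\<bar> \<le> B \<and> \<bar>M n x\<bar> \<le> B) sequentially"
      by eventually_elim (intro conjI bound)
    then have "eventually (\<lambda>n. \<bar>A n x\<bar> \<le> B) sequentially" and "eventually (\<lambda>n. \<bar>M n x\<bar> \<le> B) sequentially"
      by (auto elim: eventually_mono)
    then show ?case
      using tendsto_upperbound[OF tendsto_rabs[OF elim(1)]] tendsto_upperbound[OF tendsto_rabs[OF elim(2)]]
      by simp
  qed
  have step1: "(LINT x|lebesgue. velocity_density (1 / real (Suc k)) (\<alpha> x) (\<mu> x) (u x) x)
      + (LINT x|lebesgue. P x * weight_density N (1 / real (Suc k)) (\<alpha> x) (\<mu> x) x) = 0" for k
  proof -
    let ?c = "1 / real (Suc k)" and ?R = "sqrt (real (Suc k))"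
    \<comment> \<open>The shift by \<open>Suc k\<close> makes the bounds hold on the whole ball in which the cutoff lives.\<close>
    have in_ball: "\<bar>A (n + Suc k) x\<bar> \<le> B \<and> \<bar>M (n + Suc k) x\<bar> \<le> B \<and> x \<in> cball 0 ?R"
      if "\<not> 1 \<le> ?c * (x \<bullet> x)" for n x
    proof -
      have "x \<bullet> x < real (Suc k)" using that by (simp add: field_simps)
      moreover from this have "norm x \<le> ?R"
        by (intro real_le_rsqrt) (simp add: dot_square_norm)
      ultimately show ?thesis by (auto intro!: bound simp del: of_nat_Suc)
    qed
    have "(\<lambda>n. LINT x|lebesgue. velocity_density ?c (A (n + Suc k) x) (M (n + Suc k) x) (u x) x)
       \<longlonglongrightarrow> (LINT x|lebesgue. velocity_density ?c (\<alpha> x) (\<mu> x) (u x) x)"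
    proof (rule integral_dominated_convergence[where w="\<lambda>x. 7 * B * (norm (u x))\<^sup>2"])
      show "(\<lambda>x. velocity_density ?c (\<alpha> x) (\<mu> x) (u x) x) \<in> borel_measurable lebesgue"
        by (intro velocity_density_measurable um \<alpha>m \<mu>m)
      show "(\<lambda>x. velocity_density ?c (A (n + Suc k) x) (M (n + Suc k) x) (u x) x) \<in> borel_measurable lebesgue" for n
        by (intro velocity_density_measurable um Am Mm)
      show "integrable lebesgue (\<lambda>x. 7 * B * (norm (u x))\<^sup>2)" using ui by simp
      show "AE x in lebesgue. (\<lambda>n. velocity_density ?c (A (n + Suc k) x) (M (n + Suc k) x) (u x) x)
          \<longlonglongrightarrow> velocity_density ?c (\<alpha> x) (\<mu> x) (u x) x"
        using lim
      proof eventually_elim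
        case (elim x)
        show ?case
          by (rule density_tendsto(1)[OF LIMSEQ_ignore_initial_segment[OF elim(1)]
                LIMSEQ_ignore_initial_segment[OF elim(2)] tendsto_const])
      qed
      show "AE x in lebesgue. norm (velocity_density ?c (A (n + Suc k) x) (M (n + Suc k) x) (u x) x)
          \<le> 7 * B * (norm (u x))\<^sup>2" for n
      proof (rule AE_I2)
        fix x :: "real^'n"
        have "0 \<le> B" using bound(1)[of 0 0] by simp
        then show "norm (velocity_density ?c (A (n + Suc k) x) (M (n + Suc k) x) (u x) x) \<le> 7 * B * (norm (u x))\<^sup>2"
          using in_ball[of x n] density_eq_0[of ?c x] velocity_density_bound[of ?c "A (n + Suc k) x" B "M (n + Suc k) x" "u x" x]
          by (cases "1 \<le> ?c * (x \<bullet> x)") (auto simp del: of_nat_Suc)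
      qed
    qed
    moreover have "(\<lambda>n. LINT x|lebesgue. P x * weight_density N ?c (A (n + Suc k) x) (M (n + Suc k) x) x)
       \<longlonglongrightarrow> (LINT x|lebesgue. P x * weight_density N ?c (\<alpha> x) (\<mu> x) x)"
    proof (rule integral_dominated_convergence[where w="\<lambda>x. \<bar>indicator (cball 0 ?R) x *\<^sub>R P x\<bar> * ((N + 4) * B)"])
      show "(\<lambda>x. P x * weight_density N ?c (\<alpha> x) (\<mu> x) x) \<in> borel_measurable lebesgue"
        by (intro borel_measurable_times Pm weight_density_measurable \<alpha>m \<mu>m)
      show "(\<lambda>x. P x * weight_density N ?c (A (n + Suc k) x) (M (n + Suc k) x) x) \<in> borel_measurable lebesgue" for n
        by (intro borel_measurable_times Pm weight_density_measurable Am Mm)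
      show "integrable lebesgue (\<lambda>x. \<bar>indicator (cball 0 ?R) x *\<^sub>R P x\<bar> * ((N + 4) * B))"
        by (intro integrable_mult_left integrable_abs Lq_loc_1_props P)
      show "AE x in lebesgue. (\<lambda>n. P x * weight_density N ?c (A (n + Suc k) x) (M (n + Suc k) x) x)
          \<longlonglongrightarrow> P x * weight_density N ?c (\<alpha> x) (\<mu> x) x"
        using lim
      proof eventually_elim
        case (elim x)
        show ?case
          by (rule tendsto_mult_left[OF density_tendsto(2)[OF LIMSEQ_ignore_initial_segment[OF elim(1)]
                LIMSEQ_ignore_initial_segment[OF elim(2)] tendsto_const]])
      qed
      show "AE x in lebesgue. norm (P x * weight_density N ?c (A (n + Suc k) x) (M (n + Suc k) x) x)
          \<le> \<bar>indicator (cball 0 ?R) x *\<^sub>R P x\<bar> * ((N + 4) * B)" for n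
      proof (rule AE_I2)
        fix x :: "real^'n"
        have "0 \<le> B" using bound(1)[of 0 0] by simp
        show "norm (P x * weight_density N ?c (A (n + Suc k) x) (M (n + Suc k) x) x)
          \<le> \<bar>indicator (cball 0 ?R) x *\<^sub>R P x\<bar> * ((N + 4) * B)"
        proof (cases "1 \<le> ?c * (x \<bullet> x)")
          case True
          show ?thesis using density_eq_0(2)[OF True] \<open>0 \<le> B\<close> N by (simp del: of_nat_Suc)
        next
          case False
          from in_ball[OF False, of n] show ?thesis
            using weight_density_bound[of ?c N "A (n + Suc k) x" B "M (n + Suc k) x" x] N
            by (auto simp: abs_mult simp del: of_nat_Suc mem_cball_0 intro!: mult_left_mono)
        qed
      qed
    qed
    ultimately have "(\<lambda>n. (LINT x|lebesgue. velocity_density ?c (A (n + Suc k) x) (M (n + Suc k) x) (u x) x)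
       + (LINT x|lebesgue. P x * weight_density N ?c (A (n + Suc k) x) (M (n + Suc k) x) x))
       \<longlonglongrightarrow> (LINT x|lebesgue. velocity_density ?c (\<alpha> x) (\<mu> x) (u x) x)
       + (LINT x|lebesgue. P x * weight_density N ?c (\<alpha> x) (\<mu> x) x)" by (rule tendsto_add)
    then show ?thesis unfolding balance by (simp add: LIMSEQ_const_iff)
  qed
  have c0: "(\<lambda>k. 1 / real (Suc k)) \<longlonglongrightarrow> 0"
    using LIMSEQ_inverse_real_of_nat by (simp add: inverse_eq_divide)
  have vel_lim: "(\<lambda>k. LINT x|lebesgue. velocity_density (1 / real (Suc k)) (\<alpha> x) (\<mu> x) (u x) x)
       \<longlonglongrightarrow> (LINT x|lebesgue. velocity_density 0 (\<alpha> x) (\<mu> x) (u x) x)"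
    and vel_int: "integrable lebesgue (\<lambda>x. velocity_density 0 (\<alpha> x) (\<mu> x) (u x) x)"
  proof -
    have m: "(\<lambda>x. velocity_density c (\<alpha> x) (\<mu> x) (u x) x) \<in> borel_measurable lebesgue" for c
        by (intro velocity_density_measurable um \<alpha>m \<mu>m)
    have d: "integrable lebesgue (\<lambda>x. 7 * B * (norm (u x))\<^sup>2)" using ui by simp
    have l: "AE x in lebesgue. (\<lambda>k. velocity_density (1 / real (Suc k)) (\<alpha> x) (\<mu> x) (u x) x)
          \<longlonglongrightarrow> velocity_density 0 (\<alpha> x) (\<mu> x) (u x) x"
      by (rule AE_I2, rule density_tendsto(1)[OF tendsto_const tendsto_const c0])
    have b: "AE x in lebesgue. norm (velocity_density (1 / real (Suc k)) (\<alpha> x) (\<mu> x) (u x) x) \<le> 7 * B * (norm (u x))\<^sup>2" for k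
      using B by eventually_elim (use velocity_density_bound[of "1 / real (Suc k)"] in \<open>auto simp del: of_nat_Suc\<close>)
    show "(\<lambda>k. LINT x|lebesgue. velocity_density (1 / real (Suc k)) (\<alpha> x) (\<mu> x) (u x) x)
       \<longlonglongrightarrow> (LINT x|lebesgue. velocity_density 0 (\<alpha> x) (\<mu> x) (u x) x)"
      by (rule integral_dominated_convergence[OF m m d l b])
    show "integrable lebesgue (\<lambda>x. velocity_density 0 (\<alpha> x) (\<mu> x) (u x) x)"
      by (rule integrable_dominated_convergence[OF m m d l b])
  qed
  have "(\<lambda>k. LINT x|lebesgue. P x * weight_density N (1 / real (Suc k)) (\<alpha> x) (\<mu> x) x)
       \<longlonglongrightarrow> (LINT x|lebesgue. P x * weight_density N 0 (\<alpha> x) (\<mu> x) x)"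
  proof (rule integral_dominated_convergence[where w="\<lambda>x. 5 * \<bar>P x * (\<alpha> x + (N - 1) * \<mu> x)\<bar>"])
    show "(\<lambda>x. P x * weight_density N 0 (\<alpha> x) (\<mu> x) x) \<in> borel_measurable lebesgue"
      by (intro borel_measurable_times Pm weight_density_measurable \<alpha>m \<mu>m)
    show "(\<lambda>x. P x * weight_density N (1 / real (Suc k)) (\<alpha> x) (\<mu> x) x) \<in> borel_measurable lebesgue" for k
      by (intro borel_measurable_times Pm weight_density_measurable \<alpha>m \<mu>m)
    show "integrable lebesgue (\<lambda>x. 5 * \<bar>P x * (\<alpha> x + (N - 1) * \<mu> x)\<bar>)" using weight(1) by simp
    show "AE x in lebesgue. (\<lambda>k. P x * weight_density N (1 / real (Suc k)) (\<alpha> x) (\<mu> x) x)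
          \<longlonglongrightarrow> P x * weight_density N 0 (\<alpha> x) (\<mu> x) x"
      by (rule AE_I2, rule tendsto_mult_left[OF density_tendsto(2)[OF tendsto_const tendsto_const c0]])
    show "AE x in lebesgue. norm (P x * weight_density N (1 / real (Suc k)) (\<alpha> x) (\<mu> x) x)
        \<le> 5 * \<bar>P x * (\<alpha> x + (N - 1) * \<mu> x)\<bar>" for k
      using pos
    proof eventually_elim
      case (elim x)
      have "\<bar>weight_density N (1 / real (Suc k)) (\<alpha> x) (\<mu> x) x\<bar> \<le> 5 * (\<alpha> x + (N - 1) * \<mu> x)"
        using elim N by (intro weight_density_le_weight) auto
      moreover have "0 \<le> \<alpha> x + (N - 1) * \<mu> x" using elim N by simp
      ultimately have "\<bar>P x\<bar> * \<bar>weight_density N (1 / real (Suc k)) (\<alpha> x) (\<mu> x) x\<bar> \<le> \<bar>P x\<bar> * (5 * \<bar>\<alpha> x + (N - 1) * \<mu> x\<bar>)"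
        by (intro mult_left_mono) auto
      then show ?case by (simp add: abs_mult)
    qed
  qed
  from tendsto_add[OF vel_lim this]
  have sum0: "(LINT x|lebesgue. velocity_density 0 (\<alpha> x) (\<mu> x) (u x) x)
      + (LINT x|lebesgue. P x * weight_density N 0 (\<alpha> x) (\<mu> x) x) = 0"
    unfolding step1 by (simp add: LIMSEQ_const_iff)
  have "(LINT x|lebesgue. P x * weight_density N 0 (\<alpha> x) (\<mu> x) x)
      = (LINT x|lebesgue. P x * (\<alpha> x + (N - 1) * \<mu> x)) * flat 0 1"
    by (simp add: weight_density_def mult.assoc[symmetric])
  then have "0 \<le> (LINT x|lebesgue. P x * weight_density N 0 (\<alpha> x) (\<mu> x) x)"
    using weight(2) flat_nonneg by simp
  then have le: "(LINT x|lebesgue. velocity_density 0 (\<alpha> x) (\<mu> x) (u x) x) \<le> 0" using sum0 by linarith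
  have split: "velocity_density 0 (\<alpha> x) (\<mu> x) (u x) x
     = flat 0 1 * ((u x \<bullet> x)\<^sup>2 / (x \<bullet> x) * \<alpha> x + ((norm (u x))\<^sup>2 - (u x \<bullet> x)\<^sup>2 / (x \<bullet> x)) * \<mu> x)" for x
    by (simp add: velocity_density_def algebra_simps)
  have parts: "0 \<le> (u x \<bullet> x)\<^sup>2 / (x \<bullet> x)" "0 \<le> (norm (u x))\<^sup>2 - (u x \<bullet> x)\<^sup>2 / (x \<bullet> x)" for x
    using square_inner_le[of "u x" x] by (cases "x = 0"; auto simp: divide_le_eq)+
  have nonneg: "AE x in lebesgue. 0 \<le> velocity_density 0 (\<alpha> x) (\<mu> x) (u x) x"
    using pos unfolding split
    by eventually_elim (intro mult_nonneg_nonneg add_nonneg_nonneg flat_nonneg parts less_imp_le)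
  then have "0 \<le> (LINT x|lebesgue. velocity_density 0 (\<alpha> x) (\<mu> x) (u x) x)" by (rule integral_nonneg_AE)
  with le have "AE x in lebesgue. velocity_density 0 (\<alpha> x) (\<mu> x) (u x) x = 0"
    using integral_nonneg_eq_0_iff_AE[OF vel_int nonneg] by simp
  with pos show ?thesis
  proof eventually_elim
    case (elim x)
    have "(u x \<bullet> x)\<^sup>2 / (x \<bullet> x) * \<alpha> x + ((norm (u x))\<^sup>2 - (u x \<bullet> x)\<^sup>2 / (x \<bullet> x)) * \<mu> x = 0"
      using elim(3) unfolding split by (simp add: flat_def)
    moreover have "0 \<le> (u x \<bullet> x)\<^sup>2 / (x \<bullet> x) * \<alpha> x" "0 \<le> ((norm (u x))\<^sup>2 - (u x \<bullet> x)\<^sup>2 / (x \<bullet> x)) * \<mu> x"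
      using elim by (auto intro!: mult_nonneg_nonneg parts)
    ultimately have "(u x \<bullet> x)\<^sup>2 / (x \<bullet> x) * \<alpha> x = 0" "((norm (u x))\<^sup>2 - (u x \<bullet> x)\<^sup>2 / (x \<bullet> x)) * \<mu> x = 0"
      by linarith+
    then have "(u x \<bullet> x)\<^sup>2 / (x \<bullet> x) = 0" "(norm (u x))\<^sup>2 - (u x \<bullet> x)\<^sup>2 / (x \<bullet> x) = 0"
      using elim by (metis less_irrefl mult_eq_0_iff)+
    then have "(norm (u x))\<^sup>2 = 0" by linarith
    then show ?case by simp
  qed
qed

section \<open>Radial averages of the weight\<close>

text \<open>On monomials the operator \<open>K \<mapsto> 2 K + 4 s K'\<close> is multiplication by
  \<open>2 + 4 j\<close>.\<close>

lemma exists_averaging_poly: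
  fixes q :: "real poly"
  obtains K where "smult 2 K + smult 4 (pCons 0 (pderiv K)) = q"
proof -
  have "\<exists>K. smult 2 K + smult 4 (pCons 0 (pderiv K)) = monom a j" for a :: real and j
  proof (rule exI[of _ "monom (a / (2 + 4 * real j)) j"], rule poly_eqI)
    fix i
    have "2 * b + 4 * (real j * b) = (2 + 4 * real j) * b" for b by (simp add: algebra_simps)
    also have "(2 + 4 * real j) * (a / (2 + 4 * real j)) = a" by (simp add: add_nonneg_eq_0_iff)
    finally have "2 * (a / (2 + 4 * real j)) + 4 * (real j * (a / (2 + 4 * real j))) = a" .
    then show "coeff (smult 2 (monom (a / (2 + 4 * real j)) j) + smult 4 (pCons 0 (pderiv (monom (a / (2 + 4 * real j)) j)))) i
        = coeff (monom a j) i"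
      by (cases i) (auto simp: coeff_pderiv coeff_pCons)
  qed
  then obtain L :: "real \<Rightarrow> nat \<Rightarrow> real poly" where L: "\<And>a j. smult 2 (L a j) + smult 4 (pCons 0 (pderiv (L a j))) = monom a j" by metis
  define S where "S d = (\<Sum>j\<le>d. L (coeff q j) j)" for d
  have "smult 2 (S d) + smult 4 (pCons 0 (pderiv (S d))) = (\<Sum>j\<le>d. monom (coeff q j) j)" for d
  proof (induction d)
    case (Suc d)
    have "S (Suc d) = S d + L (coeff q (Suc d)) (Suc d)" by (simp add: S_def)
    moreover have "pCons 0 (a + b) = pCons 0 a + pCons 0 b" for a b :: "real poly" by simp
    ultimately have "smult 2 (S (Suc d)) + smult 4 (pCons 0 (pderiv (S (Suc d))))
        = (smult 2 (S d) + smult 4 (pCons 0 (pderiv (S d))))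
        + (smult 2 (L (coeff q (Suc d)) (Suc d)) + smult 4 (pCons 0 (pderiv (L (coeff q (Suc d)) (Suc d)))))"
      by (simp only: pderiv_add smult_add_right ac_simps)
    then show ?case unfolding Suc L by simp
  qed (simp only: S_def atMost_0 L sum.insert sum.empty finite.emptyI empty_iff not_False_eq_True add_0_right)
  then show thesis using that[of "S (degree q)"] poly_as_sum_of_monoms[of q] by metis
qed

text \<open>The reason for the equation satisfied by \<open>K\<close>: it says that \<open>2 K
  (r\<^sup>2) r\<close> is a primitive of \<open>q (r\<^sup>2)\<close>. So when \<open>q
  (r\<^sup>2)\<close> stands for \<open>w r\<close>, the polynomial \<open>2 K (r\<^sup>2)\<close>
  stands for \<open>W(r)/r\<close>.\<close>

lemma averaging_poly_integral:
  fixes K q :: "real poly"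
  assumes K: "smult 2 K + smult 4 (pCons 0 (pderiv K)) = q" and r: "0 \<le> r"
  shows "2 * poly K (r\<^sup>2) * r = (LINT s:{0..r}|lebesgue. poly q (s\<^sup>2))"
proof -
  have q: "poly q s = 2 * poly K s + 4 * (s * poly (pderiv K) s)" for s
    by (simp add: K[symmetric])
  have "((\<lambda>s. poly q (s\<^sup>2)) has_integral (2 * poly K (r\<^sup>2) * r - 2 * poly K (0\<^sup>2) * 0)) {0..r}"
  proof (rule fundamental_theorem_of_calculus[OF r])
    fix s
    have "((\<lambda>s. 2 * poly K (s\<^sup>2) * s) has_real_derivative poly q (s\<^sup>2)) (at s within {0..r})"
      by (rule derivative_eq_intros DERIV_chain2[OF poly_DERIV] refl | simp)+
        (simp add: q power2_eq_square algebra_simps)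
    then show "((\<lambda>s. 2 * poly K (s\<^sup>2) * s) has_vector_derivative poly q (s\<^sup>2)) (at s within {0..r})"
      by (simp add: has_real_derivative_iff_has_vector_derivative)
  qed
  moreover have "(\<lambda>s. poly q (s\<^sup>2)) absolutely_integrable_on {0..r}"
    by (intro absolutely_integrable_continuous_real continuous_intros)
  ultimately show ?thesis
    by (simp add: set_lebesgue_integral_eq_integral integral_unique)
qed

text \<open>Both the limit and the bound come from writing \<open>2 K (r\<^sup>2)\<close> as the
  mean of \<open>q (s\<^sup>2)\<close> over \<open>[0, r]\<close>; the polynomials are bounded
  there as soon as \<open>r\<^sup>2 \<le> n\<close>.\<close>

lemma radial_averages_converge:
  fixes q K :: "nat \<Rightarrow> real poly" and w :: "real \<Rightarrow> real"
  assumes K: "\<And>n. smult 2 (K n) + smult 4 (pCons 0 (pderiv (K n))) = q n"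
    and bound: "\<And>n s. \<bar>s\<bar> \<le> real n \<Longrightarrow> \<bar>poly (q n) s\<bar> \<le> B"
    and lim: "AE s in lebesgue. 0 < s \<longrightarrow> (\<lambda>n. poly (q n) (s\<^sup>2)) \<longlonglongrightarrow> w s"
    and r: "0 < r"
  shows "(\<lambda>n. 2 * poly (K n) (r\<^sup>2)) \<longlonglongrightarrow> (LINT s:{0..r}|lebesgue. w s) / r"
    and "\<And>n. r\<^sup>2 \<le> real n \<Longrightarrow> \<bar>2 * poly (K n) (r\<^sup>2)\<bar> \<le> B"
    and "integrable lebesgue (\<lambda>s. indicator {0..r} s *\<^sub>R w s)"
proof -
  obtain n0 where n0: "r\<^sup>2 \<le> real n0" using real_arch_simple by blast
  have int: "integrable lebesgue (\<lambda>s. indicator {0..r} s *\<^sub>R B)"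
    by (intro integrable_scaleR_left integrable_real_indicator) (simp_all add: emeasure_lborel_Icc r less_imp_le)
  have le: "norm (indicator {0..r} s *\<^sub>R poly (q n) (s\<^sup>2)) \<le> indicator {0..r} s *\<^sub>R B" if n: "r\<^sup>2 \<le> real n" for n s
  proof (cases "s \<in> {0..r}")
    case True
    then have "s\<^sup>2 \<le> r\<^sup>2" by (intro power_mono) auto
    then show ?thesis using True n bound[of "s\<^sup>2" n] by simp
  qed simp
  have m: "(\<lambda>s. indicator {0..r} s *\<^sub>R poly (q n) (s\<^sup>2)) \<in> borel_measurable lebesgue" for n
    by (intro borel_measurable_scaleR borel_measurable_indicator lebesgue_measurable_continuous continuous_intros) simp
  have l: "AE s in lebesgue. (\<lambda>n. indicator {0..r} s *\<^sub>R poly (q (n + n0)) (s\<^sup>2)) \<longlonglongrightarrow> indicator {0..r} s *\<^sub>R w s"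
  proof -
    have "AE s in lebesgue. s \<noteq> (0::real)" by (simp add: AE_completion_iff AE_lborel_singleton)
    with lim show ?thesis
    proof eventually_elim
      case (elim s)
      show ?case
      proof (cases "s \<in> {0..r}")
        case True
        then have "(\<lambda>n. poly (q n) (s\<^sup>2)) \<longlonglongrightarrow> w s" using elim by auto
        from LIMSEQ_ignore_initial_segment[OF this, of n0] True show ?thesis by simp
      qed simp
    qed
  qed
  have wm: "(\<lambda>s. indicator {0..r} s *\<^sub>R w s) \<in> borel_measurable lebesgue"
    by (rule borel_measurable_AE_LIMSEQ[OF m l])
  have b: "AE s in lebesgue. norm (indicator {0..r} s *\<^sub>R poly (q (n + n0)) (s\<^sup>2)) \<le> indicator {0..r} s *\<^sub>R B" for n
    using n0 by (intro AE_I2 le) simp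
  have "(\<lambda>n. LINT s|lebesgue. indicator {0..r} s *\<^sub>R poly (q (n + n0)) (s\<^sup>2)) \<longlonglongrightarrow> (LINT s|lebesgue. indicator {0..r} s *\<^sub>R w s)"
    by (rule integral_dominated_convergence[OF wm m int l b])
  moreover have "(LINT s|lebesgue. indicator {0..r} s *\<^sub>R poly (q n) (s\<^sup>2)) = 2 * poly (K n) (r\<^sup>2) * r" for n
    using averaging_poly_integral[OF K, of r n] r by (simp add: set_lebesgue_integral_def)
  ultimately have "(\<lambda>n. 2 * poly (K (n + n0)) (r\<^sup>2) * r / r) \<longlonglongrightarrow> (LINT s:{0..r}|lebesgue. w s) / r"
    unfolding set_lebesgue_integral_def using r by (intro tendsto_divide tendsto_const) auto
  then show "(\<lambda>n. 2 * poly (K n) (r\<^sup>2)) \<longlonglongrightarrow> (LINT s:{0..r}|lebesgue. w s) / r"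
    using r LIMSEQ_offset[of "\<lambda>n. 2 * poly (K n) (r\<^sup>2)" n0] by simp
  show "integrable lebesgue (\<lambda>s. indicator {0..r} s *\<^sub>R w s)"
    by (rule integrable_dominated_convergence[OF wm m int l b])
  show "\<bar>2 * poly (K n) (r\<^sup>2)\<bar> \<le> B" if n: "r\<^sup>2 \<le> real n" for n
  proof -
    have "\<bar>2 * poly (K n) (r\<^sup>2) * r\<bar> = \<bar>LINT s|lebesgue. indicator {0..r} s *\<^sub>R poly (q n) (s\<^sup>2)\<bar>"
      using averaging_poly_integral[OF K, of r n] r by (simp add: set_lebesgue_integral_def)
    also have "\<dots> \<le> (LINT s|lebesgue. indicator {0..r} s *\<^sub>R B)"
      by (rule abs_integral_le[OF int]) (use le[OF n] in simp)
    also have "\<dots> = B * r"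
      using r by (simp add: measure_lborel_Icc)
    finally show ?thesis using r by (simp add: abs_mult)
  qed
qed

lemma radial_average_pos:
  fixes w :: "real \<Rightarrow> real"
  assumes i: "integrable lebesgue (\<lambda>s. indicator {0..r} s *\<^sub>R w s)"
    and w: "AE s in lebesgue. 0 < s \<longrightarrow> 0 < w s" and r: "0 < r"
  shows "0 < (LINT s:{0..r}|lebesgue. w s) / r"
proof -
  have z: "AE s in lebesgue. s \<noteq> (0::real)" by (simp add: AE_completion_iff AE_lborel_singleton)
  have nn: "AE s in lebesgue. 0 \<le> indicator {0..r} s *\<^sub>R w s"
    using w z by eventually_elim (auto simp: indicator_def)
  have "(LINT s|lebesgue. indicator {0..r} s *\<^sub>R w s) \<noteq> 0"
  proof
    assume "(LINT s|lebesgue. indicator {0..r} s *\<^sub>R w s) = 0"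
    then have "AE s in lebesgue. indicator {0..r} s *\<^sub>R w s = 0"
      using integral_nonneg_eq_0_iff_AE[OF i nn] by simp
    with w have "AE s in lebesgue. s \<notin> {0<..<r}"
      by eventually_elim auto
    then have "AE s in lborel. s \<notin> {0<..<r}" by (simp only: AE_completion_iff)
    then have "{0<..<r} \<in> null_sets lborel" by (subst AE_iff_null_sets) auto
    then show False using r by (simp add: null_sets_def)
  qed
  moreover have "0 \<le> (LINT s|lebesgue. indicator {0..r} s *\<^sub>R w s)" by (rule integral_nonneg_AE[OF nn])
  ultimately show ?thesis using r by (simp add: set_lebesgue_integral_def)
qed

text \<open>Here the equation for \<open>K\<close> trades \<open>4 s K'\<close> for \<open>q - 2
  K\<close>, so the derivative of the approximating profile disappears and only \<open>q\<close>
  and \<open>K\<close> have to converge.\<close>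

lemma cutoff_densities:
  fixes u x :: "real^'n::finite"
  assumes K: "smult 2 K + smult 4 (pCons 0 (pderiv K)) = q"
  shows "(u \<bullet> x)\<^sup>2 * (4 * cutoff1 K c (x \<bullet> x)) + (norm u)\<^sup>2 * (2 * cutoff K c (x \<bullet> x))
      = velocity_density c (poly q (x \<bullet> x)) (2 * poly K (x \<bullet> x)) u x" (is ?V)
    and "4 * (x \<bullet> x) * cutoff1 K c (x \<bullet> x) + 2 * real CARD('n) * cutoff K c (x \<bullet> x)
      = weight_density (real CARD('n)) c (poly q (x \<bullet> x)) (2 * poly K (x \<bullet> x)) x"
proof -
  have q: "poly q s - 2 * poly K s = 4 * (s * poly (pderiv K) s)" for s
    by (simp add: K[symmetric])
  then have q': "poly q s = 2 * poly K s + 4 * (s * poly (pderiv K) s)" for s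
    by (simp add: algebra_simps)
  show ?V
    by (cases "x = 0") (simp_all add: velocity_density_def cutoff_def cutoff1_def q algebra_simps)
  show "4 * (x \<bullet> x) * cutoff1 K c (x \<bullet> x) + 2 * real CARD('n) * cutoff K c (x \<bullet> x)
      = weight_density (real CARD('n)) c (poly q (x \<bullet> x)) (2 * poly K (x \<bullet> x)) x"
    by (simp add: weight_density_def cutoff_def cutoff1_def q' algebra_simps)
qed

section \<open>The Liouville theorem\<close>

theorem corollary1p1:
  fixes v f :: "real^'n::finite \<Rightarrow> real \<Rightarrow> real^'n"
    and p :: "real^'n \<Rightarrow> real \<Rightarrow> real"
    and v0 :: "real^'n \<Rightarrow> real^'n"
    and T \<nu> :: real
  assumes "CARD('n) \<ge> 2" and "T > 0" and "\<nu> > 0"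
    and "f \<in> time_Lq 2 T {Lq_norm 2 lebesgue} (Lq_sigma 2)"
    and "Leray_weak_solution \<nu> T f v0 v p"
    and "AE t in lebesgue_on {0<..<T}. ess_vanishes_at_infinity (\<lambda>x. p x t)"
    and "\<exists>w::real \<Rightarrow> real. set_integrable lebesgue {0<..} w \<and>
           (\<exists>C>0. AE r in lebesgue_on {0..}. 0 < w r \<and> w r \<le> C / (1 + r)) \<and>
           (AE t in lebesgue_on {0<..<T}.
              integrable lebesgue (\<lambda>x. p x t * pressure_weight w x) \<and>
              (LINT x|lebesgue. p x t * pressure_weight w x) \<ge> 0)"
  shows "AE (x, t) in lebesgue_on (UNIV \<times> {0<..<T}). v x t = 0"
proof -
  obtain w C where w_int: "set_integrable lebesgue {0<..} w" and C: "0 < C"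
    and w: "AE r in lebesgue_on {0..}. 0 < w r \<and> w r \<le> C / (1 + r)"
    and pw: "AE t in lebesgue_on {0<..<T}. integrable lebesgue (\<lambda>x. p x t * pressure_weight w x) \<and>
              (LINT x|lebesgue. p x t * pressure_weight w x) \<ge> 0"
    using assms(7) by blast
  have sol: "NS_weak_solution \<nu> T f v p" and v: "v \<in> time_Lq \<infinity> T {Lq_norm 2 lebesgue} (Lq_sigma 2)"
    using assms(5) by (auto simp: Leray_weak_solution_def)
  have wC: "AE r in lebesgue. 0 < r \<longrightarrow> 0 < w r \<and> w r \<le> C"
  proof -
    have "AE r in lebesgue. r \<in> {0..} \<longrightarrow> 0 < w r \<and> w r \<le> C / (1 + r)"
      using w by (subst (asm) AE_restrict_space_iff) auto
    then show ?thesis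
    proof eventually_elim
      case (elim r)
      show ?case
      proof
        assume "0 < r"
        then have "C / (1 + r) \<le> C / 1" using C by (intro divide_left_mono) auto
        then show "0 < w r \<and> w r \<le> C" using elim \<open>0 < r\<close> by auto
      qed
    qed
  qed
  \<comment> \<open>Nothing is known about \<open>w\<close> at negative arguments, so it is cut off there before it is approximated.\<close>
  define g where "g r = indicator {0<..} r *\<^sub>R w r" for r
  have gm: "g \<in> borel_measurable lebesgue"
    using w_int unfolding set_integrable_def g_def by (rule borel_measurable_integrable)
  have gC: "AE r in lebesgue. \<bar>g r\<bar> \<le> C"
    using wC by eventually_elim (use C in \<open>auto simp: g_def indicator_def\<close>)
  obtain q where q: "\<And>n s. \<bar>s\<bar> \<le> real n \<Longrightarrow> \<bar>poly (q n) s\<bar> \<le> C + 1"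
    and q_lim: "AE r in lebesgue. \<forall>s. sqrt s = r \<longrightarrow> (\<lambda>n. poly (q n) s) \<longlonglongrightarrow> g r"
    using polynomials_converge_AE[OF gm less_imp_le[OF C] gC continuous_on_real_sqrt[OF continuous_on_id]]
    by blast
  have q_lim': "AE s in lebesgue. 0 < s \<longrightarrow> (\<lambda>n. poly (q n) (s\<^sup>2)) \<longlonglongrightarrow> w s"
    using q_lim
  proof eventually_elim
    case (elim s)
    show ?case
    proof
      assume "0 < s"
      then show "(\<lambda>n. poly (q n) (s\<^sup>2)) \<longlonglongrightarrow> w s"
        using elim[rule_format, of "s\<^sup>2"] by (simp add: g_def)
    qed
  qed
  have "\<forall>n. \<exists>K. smult 2 K + smult 4 (pCons 0 (pderiv K)) = q n"
    using exists_averaging_poly by blast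
  from choice[OF this] obtain K where K: "\<And>n. smult 2 (K n) + smult 4 (pCons 0 (pderiv (K n))) = q n"
    by blast
  define \<mu> where "\<mu> r = (LINT s:{0..r}|lebesgue. w s) / r" for r
  note avg = radial_averages_converge[OF K q q_lim', folded \<mu>_def]
  have nonzero: "AE x in lebesgue. x \<noteq> (0::real^'n)" by (simp add: AE_completion_iff AE_lborel_singleton)
  have pweight: "pressure_weight w x = w (norm x) + (real CARD('n) - 1) * \<mu> (norm x)" for x :: "real^'n"
    by (simp add: pressure_weight_def \<mu>_def)
  have all_balance: "AE t in lebesgue_on {0<..<T}. \<forall>n k.
     (LINT x|lebesgue. velocity_density (1 / real (Suc k)) (poly (q n) (x \<bullet> x)) (2 * poly (K n) (x \<bullet> x)) (v x t) x)
   + (LINT x|lebesgue. p x t * weight_density (real CARD('n)) (1 / real (Suc k)) (poly (q n) (x \<bullet> x)) (2 * poly (K n) (x \<bullet> x)) x) = 0"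
    unfolding AE_all_countable
  proof (intro allI)
    fix n k :: nat
    have "0 < 1 / real (Suc k)" by simp
    from pressure_equation_slice[OF sol v this, of "K n", unfolded cutoff_densities[OF K]]
    show "AE t in lebesgue_on {0<..<T}.
     (LINT x|lebesgue. velocity_density (1 / real (Suc k)) (poly (q n) (x \<bullet> x)) (2 * poly (K n) (x \<bullet> x)) (v x t) x)
   + (LINT x|lebesgue. p x t * weight_density (real CARD('n)) (1 / real (Suc k)) (poly (q n) (x \<bullet> x)) (2 * poly (K n) (x \<bullet> x)) x) = 0" .
  qed
  have slices: "AE t in lebesgue_on {0<..<T}. (\<lambda>x. v x t) \<in> Lq_sigma 2" "AE t in lebesgue_on {0<..<T}. (\<lambda>x. p x t) \<in> Lq_loc 1"
    using sol v by (auto simp: NS_weak_solution_def time_Lq_def)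
  have "AE t in lebesgue_on {0<..<T}. AE x in lebesgue. v x t = 0"
    using all_balance slices pw
  proof eventually_elim
    case (elim t)
    show ?case
    proof (rule vanishing_from_balance[where P="\<lambda>x. p x t" and N="real CARD('n)" and B="C + 1"
        and A="\<lambda>n x. poly (q n) (x \<bullet> x)" and M="\<lambda>n x. 2 * poly (K n) (x \<bullet> x)"
        and \<alpha>="\<lambda>x. w (norm x)" and \<mu>="\<lambda>x. \<mu> (norm x)"])
      show "2 \<le> real CARD('n)" using assms(1) by simp
      show "(\<lambda>x. v x t) \<in> Lq 2 lebesgue" using elim(2) by (simp add: Lq_sigma_def)
      show "(\<lambda>x. p x t) \<in> Lq_loc 1" by (rule elim(3))
      show "continuous_on UNIV (\<lambda>x::real^'n. poly (q n) (x \<bullet> x))" for n by (intro continuous_intros)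
      show "continuous_on UNIV (\<lambda>x::real^'n. 2 * poly (K n) (x \<bullet> x))" for n by (intro continuous_intros)
      show "\<bar>poly (q n) (x \<bullet> x)\<bar> \<le> C + 1" if "x \<bullet> x \<le> real n" for n and x :: "real^'n"
        using q[of "x \<bullet> x" n] that by simp
      show "\<bar>2 * poly (K n) (x \<bullet> x)\<bar> \<le> C + 1" if "x \<bullet> x \<le> real n" for n and x :: "real^'n"
      proof (cases "x = 0")
        case True
        \<comment> \<open>At the centre the mean over \<open>[0, r]\<close> degenerates; there the equation for \<open>K\<close> gives the bound directly.\<close>
        have "2 * poly (K n) 0 = poly (q n) 0" by (simp add: K[symmetric])
        then show ?thesis using True q[of 0 n] by simp
      next
        case False
        then show ?thesis using avg(2)[of "norm x" n] that by (simp add: dot_square_norm)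
      qed
      show "AE x in lebesgue. (\<lambda>n. poly (q n) (x \<bullet> x)) \<longlonglongrightarrow> w (norm (x::real^'n))"
        using AE_norm[OF q_lim'] nonzero by eventually_elim (simp add: dot_square_norm)
      show "AE x in lebesgue. (\<lambda>n. 2 * poly (K n) (x \<bullet> x)) \<longlonglongrightarrow> \<mu> (norm (x::real^'n))"
        using nonzero by eventually_elim (use avg(1) in \<open>simp add: dot_square_norm\<close>)
      show "AE x in lebesgue. 0 < w (norm (x::real^'n))"
        using AE_norm[OF wC] nonzero by eventually_elim simp
      have "AE s in lebesgue. 0 < s \<longrightarrow> 0 < w s" using wC by eventually_elim auto
      then have "0 < \<mu> r" if "0 < r" for r
        unfolding \<mu>_def using radial_average_pos[OF avg(3)] that by blast
      then show "AE x in lebesgue. 0 < \<mu> (norm (x::real^'n))"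
        using nonzero by (auto elim: eventually_mono)
    qed (use elim in \<open>simp_all add: pweight del: of_nat_Suc\<close>)
  qed
  then have "AE t in lebesgue_on {0<..<T}. AE x in lebesgue. norm (v (fst (x, t)) (snd (x, t))) = 0"
    by simp
  moreover have "(\<lambda>z. norm (v (fst z) (snd z))) \<in> borel_measurable (lebesgue_on (UNIV \<times> {0<..<T}))"
    using v by (intro measurable_compose[OF _ borel_measurable_norm]) (simp add: time_Lq_def)
  ultimately have "AE z in lebesgue_on (UNIV \<times> {0<..<T}). norm (v (fst z) (snd z)) = 0"
    by (intro AE_strip_from_slices)
  then show ?thesis by eventually_elim (simp add: case_prod_beta)
qed

end
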